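(* Let $n\ge1$, let $B\subset[n]$ be a (nonempty) set of consecutive indices, let $0<q<1$ and let $C>0$ be any constant. There exists a coupling of three $q$-Mallows processes $\{\bar p_i\}$, $\{p'_i\}$ and $\{\hat p_i\}$ such that: (1) $\{\bar p_i\}$ and $\{p'_i\}$ are independent; (2) defining, for $j\in[n]$, $\pi(j):=n+1-\bar p_n(j)$, $\tau(j):=n+1-p'_n(j)$, $\hat\pi(j):=n+1-\hat p_n(j)$, and \[ \bar F:=\{j\in B:\bar p_j(j)>C\},\qquad \hat F:=\{j\in B:\hat p_j(j)>C\}, \] we have $\bar F=\hat F$ and $\mathrm{LIS}(\pi_{\bar F},\tau_{\bar F})\le \mathrm{LIS}(\hat\pi_{\bar F})$.
   Context: $[n]=\{1,\dots,n\}$. For $q>0$, a $q$-Mallows process is a stochastic process $(p_n)_{n\ge1}$ with $p_n\in S_n$, built from independent random variables $\{p_n(n)\}_{n\ge1}$ with $\mathbb P(p_n(n)=j)=\frac{q^{j-1}}{1+q+\cdots+q^{n-1}}$ for $1\le j\le n$; $p_1$ is the unique permutation of one element, and for $n\ge2$ and $i<n$, $p_n(i)=p_{n-1}(i)$ if $p_{n-1}(i)<p_n(n)$ and $p_n(i)=p_{n-1}(i)+1$ if $p_{n-1}(i)\ge p_n(n)$. For $\pi\in S_n$ and a set of indices $A=\{a_1<\cdots<a_k\}\subset[n]$, $\pi_A\in S_k$ is the induced permutation: $\pi_A(i)=j$ if $\pi(a_i)$ is the $j$-th smallest among $\pi(a_1),\dots,\pi(a_k)$. For $\sigma,\rho\in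 S_k$, $\mathrm{LIS}(\sigma,\rho)$ is the maximal $m$ for which there exist indices $i_1,\dots,i_m\in[k]$ (not necessarily increasing) with $\sigma(i_1)<\cdots<\sigma(i_m)$ and $\rho(i_1)<\cdots<\rho(i_m)$. For $\sigma\in S_k$, $\mathrm{LIS}(\sigma)$ is the usual length of the longest increasing subsequence of $\sigma$. (For $k=0$ these are $0$.) *)

theory Defs
  imports "HOL-Probability.Probability" "HOL-Combinatorics.Permutations"
begin

text \<open>
  Elements of the symmetric group $S_n$ are functions \<open>s :: nat \<Rightarrow> nat\<close> with \<open>s permutes {1..n}\<close>,
  so they are the identity outside \<open>{1..n}\<close>.  A process is written \<open>p n \<omega> i\<close> (time, sample point,
  argument of the permutation); only times \<open>n \<ge> 1\<close> are relevant.

  A coupling is a common probability space carrying the processes.  Since one cannot quantify over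
  types, such spaces are taken on the type of triples of paths \<open>nat \<Rightarrow> nat \<Rightarrow> nat\<close>; this loses nothing,
  as the joint law of three processes lives on that type.
\<close>

definition mallows_process :: "real \<Rightarrow> 'w measure \<Rightarrow> (nat \<Rightarrow> 'w \<Rightarrow> nat \<Rightarrow> nat) \<Rightarrow> bool" where
  "mallows_process q M p \<longleftrightarrow>
     (\<forall>n\<ge>1. \<forall>\<omega>\<in>space M. p n \<omega> permutes {1..n}) \<and>
     prob_space.indep_vars M (\<lambda>n. count_space {1..n}) (\<lambda>n \<omega>. p n \<omega> n) {1..} \<and>
     (\<forall>n\<ge>1. \<forall>j\<in>{1..n}.
        measure M {\<omega> \<in> space M. p n \<omega> n = j} = q ^ (j - 1) / (\<Sum>k<n. q ^ k)) \<and>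
     (\<forall>n\<ge>2. \<forall>i\<in>{1..<n}. \<forall>\<omega>\<in>space M.
        p n \<omega> i = (if p (n - 1) \<omega> i < p n \<omega> n then p (n - 1) \<omega> i else p (n - 1) \<omega> i + 1))"

definition path_space :: "(nat \<Rightarrow> nat \<Rightarrow> nat) measure" where
  "path_space = (\<Pi>\<^sub>M n\<in>{1..}. count_space {s. s permutes {1..n}})"

text \<open>
  Independence of the two processes as wholes, i.e. as random elements of \<open>path_space\<close>.  The
  restriction to the index set \<open>{1..}\<close> makes the sample paths extensional, as required for
  elements of a product measure space.
\<close>

definition indep_processes ::
  "'w measure \<Rightarrow> (nat \<Rightarrow> 'w \<Rightarrow> nat \<Rightarrow> nat) \<Rightarrow> (nat \<Rightarrow> 'w \<Rightarrow> nat \<Rightarrow> nat) \<Rightarrow> bool" where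
  "indep_processes M p p' \<longleftrightarrow>
     prob_space.indep_var M path_space (\<lambda>\<omega>. \<lambda>n\<in>{1..}. p n \<omega>) path_space (\<lambda>\<omega>. \<lambda>n\<in>{1..}. p' n \<omega>)"

text \<open>
  For finite \<open>A\<close> the \<open>i\<close>-th smallest element of \<open>A\<close> is \<open>sorted_list_of_set A ! (i - 1)\<close>; if \<open>\<pi>\<close> is
  injective on \<open>A\<close>, then \<open>\<pi> a\<close> is the \<open>j\<close>-th smallest value of \<open>\<pi>\<close> on \<open>A\<close> for \<open>j\<close> the number of
  \<open>b \<in> A\<close> with \<open>\<pi> b \<le> \<pi> a\<close>.
\<close>

definition induced_perm :: "(nat \<Rightarrow> nat) \<Rightarrow> nat set \<Rightarrow> nat \<Rightarrow> nat" where
  "induced_perm \<pi> A i =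
     (if i \<in> {1..card A} then card {b \<in> A. \<pi> b \<le> \<pi> (sorted_list_of_set A ! (i - 1))} else i)"

text \<open>
  The first argument \<open>k\<close> says in which $S_k$ the permutations live.  The maximum is over
  finite sets containing \<open>0\<close>; see the lemmas below.
\<close>

definition LIS2 :: "nat \<Rightarrow> (nat \<Rightarrow> nat) \<Rightarrow> (nat \<Rightarrow> nat) \<Rightarrow> nat" where
  "LIS2 k \<sigma> \<rho> =
     Max {m :: nat. \<exists>i\<in>{1..m} \<rightarrow> {1..k}.
               strict_mono_on {1..m} (\<lambda>t. \<sigma> (i t)) \<and> strict_mono_on {1..m} (\<lambda>t. \<rho> (i t))}"

definition LIS :: "nat \<Rightarrow> (nat \<Rightarrow> nat) \<Rightarrow> nat" where
  "LIS k \<sigma> =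
     Max {m :: nat. \<exists>i\<in>{1..m} \<rightarrow> {1..k}.
               strict_mono_on {1..m} i \<and> strict_mono_on {1..m} (\<lambda>t. \<sigma> (i t))}"

lemma increasing_length_le:
  fixes f :: "nat \<Rightarrow> nat" and m k :: nat
  assumes "i \<in> {1..m} \<rightarrow> {1..k}" and "strict_mono_on {1..m} (\<lambda>t. f (i t))"
  shows "m \<le> k"
proof -
  have "inj_on (\<lambda>t. f (i t)) {1..m}"
    using assms(2) by (rule strict_mono_on_imp_inj_on)
  then have "inj_on i {1..m}"
    unfolding inj_on_def by metis
  moreover have "i ` {1..m} \<subseteq> {1..k}"
    using assms(1) by (rule funcset_image)
  ultimately have "card {1..m} \<le> card {1..k}"
    by (rule card_inj_on_le) simp
  then show ?thesis by simp
qed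

lemma LIS2_set:
  fixes \<sigma> \<rho> :: "nat \<Rightarrow> nat" and k :: nat
  defines "S \<equiv> {m :: nat. \<exists>i\<in>{1..m} \<rightarrow> {1..k}.
     strict_mono_on {1..m} (\<lambda>t. \<sigma> (i t)) \<and> strict_mono_on {1..m} (\<lambda>t. \<rho> (i t))}"
  shows "finite S" and "0 \<in> S"
proof -
  have "m \<le> k" if m: "m \<in> S" for m
  proof -
    obtain i where "i \<in> {1..m} \<rightarrow> {1..k}" "strict_mono_on {1..m} (\<lambda>t. \<sigma> (i t))"
      using m unfolding S_def by blast
    then show ?thesis by (rule increasing_length_le[where f = \<sigma>])
  qed
  then have "S \<subseteq> {..k}" by auto
  then show "finite S" by (rule finite_subset) simp
  show "0 \<in> S" unfolding S_def mem_Collect_eq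
    by (rule bexI[where x = id]) (simp_all add: strict_mono_on_def)
qed

lemma LIS_set:
  fixes \<sigma> :: "nat \<Rightarrow> nat" and k :: nat
  defines "S \<equiv> {m :: nat. \<exists>i\<in>{1..m} \<rightarrow> {1..k}.
     strict_mono_on {1..m} i \<and> strict_mono_on {1..m} (\<lambda>t. \<sigma> (i t))}"
  shows "finite S" and "0 \<in> S"
proof -
  have "m \<le> k" if m: "m \<in> S" for m
  proof -
    obtain i where "i \<in> {1..m} \<rightarrow> {1..k}" "strict_mono_on {1..m} (\<lambda>t. \<sigma> (i t))"
      using m unfolding S_def by blast
    then show ?thesis by (rule increasing_length_le[where f = \<sigma>])
  qed
  then have "S \<subseteq> {..k}" by auto
  then show "finite S" by (rule finite_subset) simp
  show "0 \<in> S" unfolding S_def mem_Collect_eq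
    by (rule bexI[where x = id]) (simp_all add: strict_mono_on_def)
qed

end

theory Submission
  imports Defs
begin

text \<open>
  Encode \<open>p n\<close> by its insertion code \<open>x\<close>, \<open>x j = p j j\<close>, so that \<open>F = {j \<in> B. x j > C}\<close> and the law of
  the code is proportional to \<open>q\<close> to the power of its sum.  For a fixed \<open>p'\<close>, a common increasing
  subsequence of \<open>\<pi>\<close> and \<open>\<tau>\<close> over \<open>F\<close> is an increasing subsequence of \<open>\<pi>\<close> when \<open>F\<close> is ordered by \<open>\<tau>\<close>.
  Bubble-sort that order into the natural one.  One step exchanges neighbours \<open>a < b\<close> that stand
  in the wrong order.  If \<open>p b < p a\<close>, the exchange cannot destroy an increasing subsequence of \<open>\<pi>\<close>.
  If \<open>p a < p b\<close>, swapping the values of \<open>p\<close> at \<open>a\<close> and \<open>b\<close> compensates the exchange, leaves \<open>F\<close>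
  unchanged and does not decrease the probability of \<open>p\<close>.  Hence a Metropolis step proposing the
  swap couples the law of the code with itself so that \<open>F\<close> is preserved and the longest increasing
  subsequence does not get shorter; composing these couplings gives \<open>phat\<close>.
\<close>

section \<open>Insertion codes\<close>


fun insert_perm :: "(nat \<Rightarrow> nat) \<Rightarrow> nat \<Rightarrow> nat \<Rightarrow> nat" where
  "insert_perm s 0 = id"
| "insert_perm s (Suc m) = (\<lambda>i.
     if i = Suc m then s (Suc m)
     else if i \<in> {1..m} then
       (if insert_perm s m i < s (Suc m) then insert_perm s m i else insert_perm s m i + 1)
     else i)"

text \<open>The relative rank of \<open>p j\<close> among the first \<open>j\<close> values, a form
  of the Lehmer code. Later insertions keep it, so it recovers the value inserted at time
  \<open>j\<close>.\<close>

definition insert_code :: "nat \<Rightarrow> (nat \<Rightarrow> nat) \<Rightarrow> nat \<Rightarrow> nat" where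
  "insert_code n p j = (if j \<in> {1..n} then card {i \<in> {1..<j}. p i < p j} + 1 else 0)"

text \<open>The default \<open>0\<close> outside \<open>{1..n}\<close> makes a code one definite
  function and agrees with the default in \<open>Pi_pmf\<close>, so that this set is the support of
  the code law.\<close>

definition codes :: "nat \<Rightarrow> (nat \<Rightarrow> nat) set" where
  "codes n = PiE_dflt {1..n} 0 (\<lambda>j. {1..j})"

lemma insert_perm_cong:
  "(\<And>j. j \<in> {1..m} \<Longrightarrow> s j = t j) \<Longrightarrow> insert_perm s m = insert_perm t m"
proof (induction m)
  case (Suc m)
  then have "insert_perm s m = insert_perm t m" "s (Suc m) = t (Suc m)" by auto
  then show ?case by (simp only: insert_perm.simps)
qed simp

lemma insert_perm_diag: "j \<ge> 1 \<Longrightarrow> insert_perm s j j = s j"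
  by (cases j) simp_all

lemma insert_perm_permutes:
  assumes "\<And>j. j \<in> {1..m} \<Longrightarrow> s j \<in> {1..j}"
  shows "insert_perm s m permutes {1..m}"
  using assms
proof (induction m)
  case 0
  then show ?case by (simp add: permutes_def)
next
  case (Suc m)
  define p where "p = insert_perm s m"
  have p: "p permutes {1..m}" unfolding p_def using Suc by auto
  have s: "s (Suc m) \<in> {1..Suc m}" using Suc.prems[of "Suc m"] by auto
  define r where "r = insert_perm s (Suc m)"
  have r: "r i = (if i = Suc m then s (Suc m) else if i \<in> {1..m} then
       (if p i < s (Suc m) then p i else p i + 1) else i)" for i
    by (simp add: r_def p_def)
  have pm: "p i \<in> {1..m}" if "i \<in> {1..m}" for i using permutes_in_image[OF p, of i] that by simp
  have "inj_on r {1..Suc m}"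
  proof (rule inj_onI)
    fix i j assume ij: "i \<in> {1..Suc m}" "j \<in> {1..Suc m}" "r i = r j"
    have pj: "p i = p j \<longleftrightarrow> i = j" using permutes_inj[OF p] by (simp add: inj_eq)
    show "i = j"
    proof (cases "i = Suc m \<or> j = Suc m")
      case True
      then show ?thesis using ij by (auto simp: r split: if_splits)
    next
      case False
      then have "i \<in> {1..m}" "j \<in> {1..m}" using ij by auto
      then have "p i = p j" using ij(3) False by (simp add: r split: if_splits)
      then show ?thesis using pj by simp
    qed
  qed
  moreover have "r ` {1..Suc m} \<subseteq> {1..Suc m}"
  proof (rule image_subsetI)
    fix i assume "i \<in> {1..Suc m}"
    then show "r i \<in> {1..Suc m}" using s pm[of i] by (cases "i = Suc m") (simp_all add: r)
  qed
  ultimately have "bij_betw r {1..Suc m} {1..Suc m}"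
    by (metis bij_betw_def endo_inj_surj finite_atLeastAtMost)
  then show ?case unfolding r_def[symmetric]
    by (rule bij_imp_permutes) (auto simp: r)
qed

text \<open>Each later insertion applies a strictly increasing map to the old values, so the
  relative order of the first \<open>m\<close> positions is frozen at time \<open>m\<close>.\<close>

lemma insert_perm_less_iff:
  assumes "m \<le> n" "i \<in> {1..m}" "j \<in> {1..m}"
  shows "insert_perm s n i < insert_perm s n j \<longleftrightarrow> insert_perm s m i < insert_perm s m j"
  using assms(1)
proof (induction n rule: dec_induct)
  case (step k)
  then have eq: "insert_perm s (Suc k) l =
      (if insert_perm s k l < s (Suc k) then insert_perm s k l else insert_perm s k l + 1)"
    if "l \<in> {1..m}" for l
    using that by simp
  then show ?case using step.IH
    unfolding eq[OF assms(2)] eq[OF assms(3)] by (simp split: if_split) linarith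
qed simp

text \<open>The comparison can be made at time \<open>j\<close>. Before the shift the older values
  run through \<open>{1..j - 1}\<close>, and exactly those below \<open>s j\<close> stay below the
  newcomer.\<close>

lemma card_insert_perm_less:
  assumes "\<And>j. j \<in> {1..n} \<Longrightarrow> s j \<in> {1..j}" "j \<in> {1..n}"
  shows "card {i \<in> {1..<j}. insert_perm s n i < insert_perm s n j} + 1 = s j"
proof -
  obtain m where j: "j = Suc m" using assms(2) by (cases j) auto
  let ?p = "insert_perm s m"
  have p: "?p permutes {1..m}"
    by (rule insert_perm_permutes) (use assms j in auto)
  have "{i \<in> {1..<j}. insert_perm s n i < insert_perm s n j} = {i \<in> {1..m}. ?p i < s j}"
  proof -
    have "insert_perm s n i < insert_perm s n j \<longleftrightarrow> ?p i < s j" if "i \<in> {1..m}" for i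
      using insert_perm_less_iff[of j n i j s] that assms(2) j by auto
    then show ?thesis using j by auto
  qed
  moreover have "card {i \<in> {1..m}. ?p i < s j} = card (?p ` {i \<in> {1..m}. ?p i < s j})"
    by (rule card_image[symmetric]) (rule inj_on_subset[OF permutes_inj[OF p] subset_UNIV])
  moreover have "?p ` {i \<in> {1..m}. ?p i < s j} = {v \<in> ?p ` {1..m}. v < s j}" by auto
  moreover have "{v \<in> ?p ` {1..m}. v < s j} = {1..<s j}"
    using permutes_image[OF p] assms(1)[OF assms(2)] j by auto
  ultimately show ?thesis using assms(1)[OF assms(2)] by simp
qed

lemma insert_code_insert_perm: "s \<in> codes n \<Longrightarrow> insert_code n (insert_perm s n) = s"
proof
  fix j assume s: "s \<in> codes n"
  then have "s i \<in> {1..i}" if "i \<in> {1..n}" for i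
    using that unfolding codes_def PiE_dflt_def by blast
  moreover have "s j = 0" if "j \<notin> {1..n}"
    using that s unfolding codes_def PiE_dflt_def by blast
  ultimately show "insert_code n (insert_perm s n) j = s j"
    using card_insert_perm_less[of n s j] unfolding insert_code_def by presburger
qed

lemma insert_perm_codes: "s \<in> codes n \<Longrightarrow> insert_perm s n permutes {1..n}"
  by (rule insert_perm_permutes) (auto simp: codes_def PiE_dflt_def)

lemma insert_code_in_codes: "insert_code n p \<in> codes n"
proof -
  have "card {i \<in> {1..<j}. p i < p j} \<le> card {1..<j}" for j
    by (rule card_mono) auto
  then have "card {i \<in> {1..<j}. p i < p j} < j" if "j \<ge> 1" for j
    using that by (metis Suc_pred card_atLeastLessThan le_imp_less_Suc less_eq_Suc_le One_nat_def)
  then show ?thesis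
    by (auto simp: codes_def PiE_dflt_def insert_code_def Suc_le_eq)
qed

text \<open>Surjectivity of \<^const>\<open>insert_perm\<close> comes from counting: both sides have \<open>n!\<close> elements.\<close>

lemma insert_perm_insert_code:
  assumes "p permutes {1..n}"
  shows "insert_perm (insert_code n p) n = p"
proof -
  let ?f = "\<lambda>s. insert_perm s n"
  have inj: "inj_on ?f (codes n)"
    by (rule inj_on_inverseI[where g = "insert_code n"]) (rule insert_code_insert_perm)
  have "card (codes n) = (\<Prod>j\<in>{1..n}. j)"
    unfolding codes_def by (subst card_PiE_dflt) auto
  also have "\<dots> = card {p. p permutes {1..n}}"
    using card_permutations[of "{1..n}" n] by (simp add: fact_prod)
  finally have "card (?f ` codes n) = card {p. p permutes {1..n}}"
    by (simp add: card_image[OF inj])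
  then have "?f ` codes n = {p. p permutes {1..n}}"
    using insert_perm_codes by (intro card_subset_eq) (blast intro: finite_permutations)+
  then obtain s where "s \<in> codes n" "p = ?f s" using assms by blast
  then show ?thesis by (simp add: insert_code_insert_perm)
qed

section \<open>Effect of swapping two values on the insertion code\<close>

text \<open>Before \<open>a\<close> nothing changes, and beyond \<open>b\<close> the smaller
  predecessors are only relabelled. A position between them with value between \<open>p a\<close>
  and \<open>p b\<close> loses the predecessor \<open>a\<close>. The entry at \<open>a\<close> gains
  the earlier positions with value between \<open>p a\<close> and \<open>p b\<close>; the entry at
  \<open>b\<close> loses these and \<open>a\<close> as well, so the two entries together do not
  grow.\<close>

lemma insert_code_transpose:
  fixes p :: "nat \<Rightarrow> nat"
  assumes p: "inj_on p {1..n}" and ab: "a \<in> {1..n}" "b \<in> {1..n}" "a < b" and lt: "p a < p b"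
  defines "q \<equiv> p \<circ> Transposition.transpose a b"
  shows "j \<in> {1..n} \<Longrightarrow> j \<noteq> a \<Longrightarrow> j \<noteq> b \<Longrightarrow>
           insert_code n p j = insert_code n q j + of_bool (a < j \<and> j < b \<and> p a < p j \<and> p j < p b)"
    and "insert_code n p a \<le> insert_code n q a"
    and "insert_code n p a \<le> insert_code n q b"
    and "insert_code n q a + insert_code n q b \<le> insert_code n p a + insert_code n p b"
proof -
  have q: "q i = (if i = a then p b else if i = b then p a else p i)" for i
    by (auto simp: q_def Transposition.transpose_def)
  define N where "N r j = {i \<in> {1..<j}. r i < r j}" for r :: "nat \<Rightarrow> nat" and j
  have fin: "finite (N r j)" for r j by (auto simp: N_def)
  have code: "insert_code n r j = card (N r j) + 1" if "j \<in> {1..n}" for r j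
    using that by (simp add: insert_code_def N_def)
  show "insert_code n p j = insert_code n q j + of_bool (a < j \<and> j < b \<and> p a < p j \<and> p j < p b)"
    if j: "j \<in> {1..n}" "j \<noteq> a" "j \<noteq> b"
  proof -
    consider "j < a" | "a < j" "j < b" | "b < j" using j by linarith
    then show ?thesis
    proof cases
      case 1
      then have "N q j = N p j" using j ab by (auto simp: N_def q)
      then show ?thesis using 1 j by (simp add: code)
    next
      case 2
      show ?thesis
      proof (cases "p a < p j \<and> p j < p b")
        case True
        then have "N p j = insert a (N q j)" "a \<notin> N q j"
          using 2 j ab by (auto simp: N_def q)
        then show ?thesis using True 2 j by (simp add: code fin)
      next
        case False
        have "p a \<noteq> p j" "p b \<noteq> p j" using inj_onD[OF p] ab j by metis+
        then have "N q j = N p j" using False j ab 2 lt by (auto simp: N_def q)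
        then show ?thesis using False j by (simp add: code)
      qed
    next
      case 3
      have *: "Transposition.transpose a b ` N p j = N q j"
      proof
        show "Transposition.transpose a b ` N p j \<subseteq> N q j"
          using 3 ab by (auto simp: N_def q Transposition.transpose_def)
        show "N q j \<subseteq> Transposition.transpose a b ` N p j"
        proof
          fix i assume "i \<in> N q j"
          then have "Transposition.transpose a b i \<in> N p j"
            using 3 ab by (auto simp: N_def q Transposition.transpose_def split: if_splits)
          then show "i \<in> Transposition.transpose a b ` N p j"
            by (metis image_eqI transpose_involutory)
        qed
      qed
      then have "card (N q j) = card (N p j)"
        by (metis card_image inj_on_subset inj_transpose top_greatest)
      then show ?thesis using 3 j by (simp add: code)
    qed
  qed
  have a: "N q a = N p a \<union> {i \<in> {1..<a}. p a \<le> p i \<and> p i < p b}"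
    using ab lt by (auto simp: N_def q)
  have b: "N p b = N q b \<union> insert a {i \<in> {1..<b} - {a}. p a \<le> p i \<and> p i < p b}"
    using ab lt by (auto simp: N_def q)
  show "insert_code n p a \<le> insert_code n q a"
    using ab by (simp add: code a card_mono fin)
  have "N p a \<subseteq> N q b" using ab by (auto simp: N_def q)
  then show "insert_code n p a \<le> insert_code n q b"
    using ab by (simp add: code card_mono fin)
  let ?D = "{i \<in> {1..<a}. p a \<le> p i \<and> p i < p b}"
  have "card (N q a) = card (N p a) + card ?D"
    unfolding a by (rule card_Un_disjoint) (auto simp: N_def)
  moreover have "card (N q b) + card ?D = card (N q b \<union> ?D)"
    by (rule card_Un_disjoint[symmetric]) (use ab in \<open>auto simp: N_def q\<close>)
  moreover have "card (N q b \<union> ?D) \<le> card (N p b)"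
    by (rule card_mono[OF fin]) (subst b, use ab in auto)
  ultimately show "insert_code n q a + insert_code n q b \<le> insert_code n p a + insert_code n p b"
    using ab by (simp add: code)
qed

definition high :: "nat set \<Rightarrow> real \<Rightarrow> (nat \<Rightarrow> nat) \<Rightarrow> nat set" where
  "high B C s = {j \<in> B. real (s j) > C}"

text \<open>The new entries at \<open>a\<close> and \<open>b\<close> are at least the old entry at
  \<open>a\<close>, which exceeds \<open>C\<close>. A position that loses one had \<open>a\<close>
  and all smaller predecessors of \<open>a\<close> among its own, so its entry was larger than that
  at \<open>a\<close> and stays above \<open>C\<close>.\<close>

lemma high_transpose:
  fixes p :: "nat \<Rightarrow> nat"
  assumes p: "inj_on p {1..n}" and B: "B \<subseteq> {1..n}" and "a < b" "p a < p b"
    and a: "a \<in> high B C (insert_code n p)" and b: "b \<in> high B C (insert_code n p)"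
  shows "high B C (insert_code n (p \<circ> Transposition.transpose a b)) = high B C (insert_code n p)"
proof -
  have ab: "a \<in> {1..n}" "b \<in> {1..n}" using a b B by (auto simp: high_def)
  note T = insert_code_transpose[OF p ab assms(3,4)]
  let ?q = "p \<circ> Transposition.transpose a b"
  have "(real (insert_code n ?q j) > C) \<longleftrightarrow> (real (insert_code n p j) > C)" if "j \<in> B" for j
  proof -
    have j: "j \<in> {1..n}" using that B by auto
    consider "j = a" | "j = b" | "j \<noteq> a" "j \<noteq> b" by blast
    then show ?thesis
    proof cases
      case 1
      then show ?thesis using T(2) a by (auto simp: high_def)
    next
      case 2
      then show ?thesis using T(3) a b by (auto simp: high_def)
    next
      case 3
      show ?thesis
      proof (cases "a < j \<and> j < b \<and> p a < p j \<and> p j < p b")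
        case True
        have "{i \<in> {1..<a}. p i < p a} \<subset> {i \<in> {1..<j}. p i < p j}"
        proof
          show "{i \<in> {1..<a}. p i < p a} \<subseteq> {i \<in> {1..<j}. p i < p j}" using True by auto
          have "a \<in> {i \<in> {1..<j}. p i < p j}" using True ab by auto
          then show "{i \<in> {1..<a}. p i < p a} \<noteq> {i \<in> {1..<j}. p i < p j}" by force
        qed
        then have "insert_code n p a < insert_code n p j"
          using ab j by (simp add: insert_code_def psubset_card_mono)
        then show ?thesis using T(1)[OF j 3] True a by (auto simp: high_def)
      next
        case False
        then show ?thesis using T(1)[OF j 3] by auto
      qed
    qed
  qed
  then show ?thesis by (auto simp: high_def)
qed

lemma sum_insert_code_transpose:
  fixes p :: "nat \<Rightarrow> nat"
  assumes p: "inj_on p {1..n}" and ab: "a \<in> {1..n}" "b \<in> {1..n}" "a < b" and lt: "p a < p b"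
  shows "sum (insert_code n (p \<circ> Transposition.transpose a b)) {1..n} \<le> sum (insert_code n p) {1..n}"
proof -
  note T = insert_code_transpose[OF p ab lt]
  have split: "sum f {1..n} = f a + f b + sum f ({1..n} - {a, b})" for f :: "nat \<Rightarrow> nat"
    using ab by (subst sum.subset_diff[of "{a,b}"]) auto
  show ?thesis unfolding split
    by (intro add_mono T(4) sum_mono) (use T(1) in \<open>auto simp del: One_nat_def\<close>)
qed

section \<open>Sorting an order by adjacent transpositions\<close>


text \<open>With \<open>\<pi>\<close> equal to \<open>n + 1 - p\<close> and \<open>r\<close>
  injective on \<open>F\<close>, these are the sets on which \<open>r\<close> and
  \<open>\<pi>\<close> increase together: common increasing subsequences, recorded by their
  positions.\<close>

definition opposed_sets :: "nat set \<Rightarrow> (nat \<Rightarrow> nat) \<Rightarrow> (nat \<Rightarrow> nat) \<Rightarrow> nat set set" where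
  "opposed_sets F r p = {A. A \<subseteq> F \<and> (\<forall>a\<in>A. \<forall>b\<in>A. r a < r b \<longrightarrow> p b < p a)}"

text \<open>Taking \<open>\<tau>\<close> for \<open>r\<close> gives the length for two permutations,
  taking \<open>id\<close> the usual one; sorting \<open>r\<close> leads from the first to the
  second.\<close>

definition longest :: "nat set \<Rightarrow> (nat \<Rightarrow> nat) \<Rightarrow> (nat \<Rightarrow> nat) \<Rightarrow> nat" where
  "longest F r p = Max (card ` opposed_sets F r p)"

lemma finite_opposed_sets: "finite F \<Longrightarrow> finite (opposed_sets F r p)"
  by (rule finite_subset[of _ "Pow F"]) (auto simp: opposed_sets_def)

lemma empty_in_opposed_sets: "{} \<in> opposed_sets F r p"
  by (simp add: opposed_sets_def)

lemma card_le_longest: "finite F \<Longrightarrow> A \<in> opposed_sets F r p \<Longrightarrow> card A \<le> longest F r p"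
  unfolding longest_def by (intro Max_ge) (auto simp: finite_opposed_sets)

lemma longestE:
  assumes "finite F"
  obtains A where "A \<in> opposed_sets F r p" "card A = longest F r p"
proof -
  have "longest F r p \<in> card ` opposed_sets F r p"
    unfolding longest_def using assms empty_in_opposed_sets
    by (intro Max_in) (auto simp: finite_opposed_sets)
  then show ?thesis using that by force
qed

lemma longest_mono:
  assumes "finite F" "opposed_sets F r p \<subseteq> opposed_sets F r' p'"
  shows "longest F r p \<le> longest F r' p'"
proof -
  obtain A where "A \<in> opposed_sets F r p" "card A = longest F r p" using longestE[OF assms(1)] .
  then show ?thesis using card_le_longest[OF assms(1), of A r' p'] assms(2) by auto
qed

text \<open>Relabelling by the transposition keeps sets inside \<open>F\<close> and preserves their
  size. Since it is an involution, one inequality yields both.\<close>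

lemma longest_transpose:
  assumes "finite F" "a \<in> F" "b \<in> F"
  shows "longest F (r \<circ> Transposition.transpose a b) (p \<circ> Transposition.transpose a b) = longest F r p"
proof -
  let ?s = "Transposition.transpose a b"
  have le: "longest F r p \<le> longest F (r \<circ> ?s) (p \<circ> ?s)" for r p
  proof -
    obtain A where A: "A \<in> opposed_sets F r p" "card A = longest F r p"
      using longestE[OF assms(1)] .
    have "?s ` A \<in> opposed_sets F (r \<circ> ?s) (p \<circ> ?s)"
      using A(1) assms by (auto simp: opposed_sets_def Transposition.transpose_def)
    moreover have "card (?s ` A) = card A"
      by (rule card_image) (rule inj_on_subset[OF inj_transpose subset_UNIV])
    ultimately show ?thesis using card_le_longest[OF assms(1)] A(2) by metis
  qed
  from le[of "r \<circ> ?s" "p \<circ> ?s"] le[of r p] show ?thesis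
    by (simp add: comp_assoc)
qed

section \<open>Inversions and exchanges of neighbouring ranks\<close>

definition inversions :: "nat \<Rightarrow> (nat \<Rightarrow> nat) \<Rightarrow> (nat \<times> nat) set" where
  "inversions n r = {(a, b). a \<in> {1..n} \<and> b \<in> {1..n} \<and> a < b \<and> r b < r a}"

lemma finite_inversions: "finite (inversions n r)"
  by (rule finite_subset[of _ "{1..n} \<times> {1..n}"]) (auto simp: inversions_def)

text \<open>Take an inversion with least gap \<open>r a - r b\<close>. A position \<open>c\<close>
  of intermediate rank would give an inversion with smaller gap: \<open>(c, b)\<close> if
  \<open>c < b\<close>, otherwise \<open>(a, c)\<close>.\<close>

lemma adjacent_inversion:
  assumes "inversions n r \<noteq> {}"
  obtains a b where "(a, b) \<in> inversions n r" "\<And>c. c \<in> {1..n} \<Longrightarrow> \<not> (r b < r c \<and> r c < r a)"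
proof -
  obtain z where "z \<in> inversions n r" using assms by blast
  then obtain y where y: "y \<in> inversions n r"
    and min: "\<And>z. z \<in> inversions n r \<Longrightarrow> r (fst y) - r (snd y) \<le> r (fst z) - r (snd z)"
    using ex_has_least_nat[of "\<lambda>z. z \<in> inversions n r" z "\<lambda>z. r (fst z) - r (snd z)"] by blast
  obtain a b where yab: "y = (a, b)" by force
  have "\<not> (r b < r c \<and> r c < r a)" if c: "c \<in> {1..n}" for c
  proof
    assume *: "r b < r c \<and> r c < r a"
    show False
    proof (cases "c < b")
      case True
      then show False using min[of "(c, b)"] * c y yab by (auto simp: inversions_def)
    next
      case False
      then show False using min[of "(a, c)"] * c y yab by (auto simp: inversions_def)
    qed
  qed
  then show ?thesis using that y yab by blast
qed

context
  fixes n :: nat and r :: "nat \<Rightarrow> nat" and a b :: nat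
  assumes inj: "inj_on r {1..n}" and ab: "(a, b) \<in> inversions n r"
    and adj: "\<And>c. c \<in> {1..n} \<Longrightarrow> \<not> (r b < r c \<and> r c < r a)"
begin

text \<open>No rank lies between \<open>r b\<close> and \<open>r a\<close>, so every other position
  compares in the same way with both.\<close>

lemma adjacent_transpose_less_iff:
  assumes "c \<in> {1..n}" "d \<in> {1..n}" "(c, d) \<noteq> (a, b)" "(c, d) \<noteq> (b, a)"
  shows "r (Transposition.transpose a b c) < r (Transposition.transpose a b d) \<longleftrightarrow> r c < r d"
proof -
  have ab': "a \<in> {1..n}" "b \<in> {1..n}" "a < b" "r b < r a" using ab by (auto simp: inversions_def)
  have neq: "r c \<noteq> r d \<or> c = d" if "c \<in> {1..n}" "d \<in> {1..n}" for c d
    using inj that by (auto dest: inj_onD)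
  show ?thesis
    using assms ab'(3,4) adj[OF assms(1)] adj[OF assms(2)] neq[OF assms(1) ab'(1)]
      neq[OF assms(1) ab'(2)] neq[OF assms(2) ab'(1)] neq[OF assms(2) ab'(2)]
    by (cases "c = a"; cases "c = b"; cases "d = a"; cases "d = b") auto
qed

text \<open>The number of inversions is the measure that makes the sort terminate: the exchange
  removes \<open>(a, b)\<close> and creates none.\<close>

lemma inversions_adjacent_transpose: "inversions n (r \<circ> Transposition.transpose a b) \<subset> inversions n r"
proof
  have "(a, b) \<notin> inversions n (r \<circ> Transposition.transpose a b)"
    using ab by (simp add: inversions_def)
  then show "inversions n (r \<circ> Transposition.transpose a b) \<noteq> inversions n r"
    using ab by blast
  show "inversions n (r \<circ> Transposition.transpose a b) \<subseteq> inversions n r"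
  proof
    fix z assume "z \<in> inversions n (r \<circ> Transposition.transpose a b)"
    then obtain c d where z: "z = (c, d)" and cd: "c \<in> {1..n}" "d \<in> {1..n}" "c < d"
      and less: "r (Transposition.transpose a b d) < r (Transposition.transpose a b c)"
      by (auto simp: inversions_def)
    show "z \<in> inversions n r"
    proof (cases "(c, d) = (a, b)")
      case True
      then show ?thesis using ab z by simp
    next
      case False
      have "(c, d) \<noteq> (b, a)" using cd ab by (auto simp: inversions_def)
      then show ?thesis
        using adjacent_transpose_less_iff[of d c] False less cd z by (auto simp: inversions_def)
    qed
  qed
qed

text \<open>The exchange creates a single new constraint, the one between \<open>a\<close> and
  \<open>b\<close>, and the second hypothesis supplies it.\<close>

lemma opposed_sets_adjacent_transpose:
  assumes "F \<subseteq> {1..n}" and "a \<in> F \<Longrightarrow> b \<in> F \<Longrightarrow> p b < p a"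
  shows "opposed_sets F r p \<subseteq> opposed_sets F (r \<circ> Transposition.transpose a b) p"
proof
  fix A assume A: "A \<in> opposed_sets F r p"
  have "p d < p c" if cd: "c \<in> A" "d \<in> A"
    and less: "r (Transposition.transpose a b c) < r (Transposition.transpose a b d)" for c d
  proof -
    have F: "c \<in> F" "d \<in> F" using A cd by (auto simp: opposed_sets_def)
    consider "(c, d) = (a, b)" | "(c, d) = (b, a)" | "(c, d) \<noteq> (a, b)" "(c, d) \<noteq> (b, a)" by blast
    then show ?thesis
    proof cases
      case 1
      then show ?thesis using assms(2) F by simp
    next
      case 2
      then show ?thesis using less ab by (simp add: inversions_def)
    next
      case 3
      then have "r c < r d" using adjacent_transpose_less_iff[of c d] F assms(1) less by blast
      then show ?thesis using A cd by (auto simp: opposed_sets_def)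
    qed
  qed
  then show "A \<in> opposed_sets F (r \<circ> Transposition.transpose a b) p"
    using A by (auto simp: opposed_sets_def)
qed

end

text \<open>The Metropolis chain with proposal \<open>T\<close> is stationary for \<open>\<mu>\<close>; one step of it is the coupling.\<close>

lemma rel_pmf_metropolis:
  assumes T: "\<And>x. T (T x) = x"
  shows "rel_pmf (\<lambda>x z. z = T x \<or> z = x \<and> pmf \<mu> (T x) < pmf \<mu> x) \<mu> \<mu>"
proof -
  define \<alpha> where "\<alpha> x = min 1 (pmf \<mu> (T x) / pmf \<mu> x)" for x
  define k where "k x = map_pmf (\<lambda>c. if c then T x else x) (bernoulli_pmf (\<alpha> x))" for x
  define J where "J = bind_pmf \<mu> (\<lambda>x. map_pmf (Pair x) (k x))"
  have \<alpha>: "0 \<le> \<alpha> x" "\<alpha> x \<le> 1" for x by (auto simp: \<alpha>_def)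
  \<comment> \<open>Detailed balance: the right side is symmetric in \<open>x\<close> and
    \<open>T x\<close>. Where \<open>pmf \<mu> x = 0\<close>, division by zero gives
    \<open>\<alpha> x = 0\<close> and both sides vanish.\<close>
  have bal: "pmf \<mu> x * \<alpha> x = min (pmf \<mu> x) (pmf \<mu> (T x))" for x
    by (auto simp: \<alpha>_def min_def field_simps pmf_nonneg divide_simps order_antisym split: if_splits)
  have k: "pmf (k x) z = (if x = z then (if T x = x then 1 else 1 - \<alpha> x) else if T x = z then \<alpha> x else 0)"
    for x z
  proof -
    have "pmf (k x) z = measure (bernoulli_pmf (\<alpha> x)) ((\<lambda>c. if c then T x else x) -` {z})"
      unfolding k_def by (simp add: pmf_map)
    also have "(\<lambda>c. if c then T x else x) -` {z} =
        (if x = z then (if T x = x then UNIV else {False}) else if T x = z then {True} else {})"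
      (is "?L = ?R")
    proof (rule set_eqI)
      fix c show "c \<in> ?L \<longleftrightarrow> c \<in> ?R" by (cases c) auto
    qed
    finally show ?thesis
      using \<alpha>[of x] by (auto simp: measure_pmf_single)
  qed
  have "map_pmf snd J = \<mu>"
  proof (rule pmf_eqI)
    fix z
    have "pmf (map_pmf snd J) z = (\<integral>x. pmf (k x) z \<partial>measure_pmf \<mu>)"
      by (simp add: J_def map_bind_pmf pmf.map_comp o_def pmf_bind)
    \<comment> \<open>As \<open>T\<close> is an involution, only \<open>z\<close> and
      \<open>T z\<close> can move to \<open>z\<close>.\<close>
    also have "\<dots> = (\<Sum>x\<in>{z, T z}. pmf (k x) z * pmf \<mu> x)"
      by (rule integral_measure_pmf_real) (use T in \<open>auto simp: k split: if_splits\<close>)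
    also have "\<dots> = pmf \<mu> z"
      using bal[of z] bal[of "T z"] T[of z]
      by (cases "T z = z") (auto simp: k algebra_simps min.commute)
    finally show "pmf (map_pmf snd J) z = pmf \<mu> z" .
  qed
  moreover have "map_pmf fst J = \<mu>"
    by (simp add: J_def map_bind_pmf pmf.map_comp o_def bind_return_pmf')
  moreover have "z = T x \<or> z = x \<and> pmf \<mu> (T x) < pmf \<mu> x" if "(x, z) \<in> set_pmf J" for x z
  proof -
    have x: "x \<in> set_pmf \<mu>" and z: "z \<in> set_pmf (k x)" using that by (auto simp: J_def)
    have "pmf \<mu> x > 0" using x by (simp add: pmf_positive)
    \<comment> \<open>Rejection needs \<open>\<alpha> x < 1\<close>, that is, a strictly less likely
      proposal. Fixed points of \<open>T\<close> fall under \<open>z = T x\<close>.\<close>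
    moreover have "z = T x \<or> z = x \<and> \<alpha> x \<noteq> 1"
      using z by (auto simp: set_pmf_iff k split: if_splits)
    ultimately show ?thesis by (auto simp: \<alpha>_def min_def field_simps split: if_splits)
  qed
  ultimately show ?thesis by (intro rel_pmf.intros)
qed

section \<open>The law of the insertion code\<close>

text \<open>For \<open>i = 0\<close> the embedded function vanishes and is no probability, whence
  the condition \<open>i \<ge> 1\<close> in the lemmas.\<close>

definition trunc_geom :: "real \<Rightarrow> nat \<Rightarrow> nat pmf" where
  "trunc_geom q i = embed_pmf (\<lambda>j. if j \<in> {1..i} then q ^ (j - 1) / (\<Sum>k<i. q ^ k) else 0)"

lemma pmf_trunc_geom:
  assumes "0 < q" "i \<ge> 1"
  shows "pmf (trunc_geom q i) j = (if j \<in> {1..i} then q ^ (j - 1) / (\<Sum>k<i. q ^ k) else 0)"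
  unfolding trunc_geom_def
proof (rule pmf_embed_pmf)
  let ?f = "\<lambda>j. if j \<in> {1..i} then q ^ (j - 1) / (\<Sum>k<i. q ^ k) else 0"
  have pos: "(\<Sum>k<i. q ^ k) > 0" using assms by (intro sum_pos) (auto simp: lessThan_empty_iff)
  then show nonneg: "?f j \<ge> 0" for j using assms by auto
  have "(\<integral>\<^sup>+j. ennreal (?f j) \<partial>count_space UNIV) = (\<Sum>j\<in>{1..i}. ennreal (?f j))"
    by (rule nn_integral_count_space'[of "{1..i}"]) auto
  also have "\<dots> = ennreal (\<Sum>j\<in>{1..i}. ?f j)"
    by (rule sum_ennreal) (use nonneg in blast)
  also have "(\<Sum>j\<in>{1..i}. ?f j) = (\<Sum>j\<in>{1..i}. q ^ (j - 1)) / (\<Sum>k<i. q ^ k)"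
    by (simp add: sum_divide_distrib)
  also have "(\<Sum>j\<in>{1..i}. q ^ (j - 1)) = (\<Sum>k<i. q ^ k)"
    by (rule sum.reindex_bij_witness[of _ Suc "\<lambda>j. j - 1"]) auto
  finally show "(\<integral>\<^sup>+j. ennreal (?f j) \<partial>count_space UNIV) = 1" using pos by simp
qed

lemma set_trunc_geom: "0 < q \<Longrightarrow> i \<ge> 1 \<Longrightarrow> set_pmf (trunc_geom q i) = {1..i}"
proof -
  assume *: "0 < q" "i \<ge> 1"
  have "(\<Sum>k<i. q ^ k) > 0" using * by (intro sum_pos) (auto simp: lessThan_empty_iff)
  then show ?thesis using * by (auto simp: set_pmf_eq pmf_trunc_geom split: if_splits)
qed

definition code_pmf :: "real \<Rightarrow> nat \<Rightarrow> (nat \<Rightarrow> nat) pmf" where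
  "code_pmf q n = Pi_pmf {1..n} 0 (trunc_geom q)"

lemma set_code_pmf:
  assumes "0 < q"
  shows "set_pmf (code_pmf q n) = codes n"
proof -
  have "(set_pmf \<circ> trunc_geom q) j = {1..j}" if "j \<in> {1..n}" for j
    using set_trunc_geom[OF assms, of j] that by simp
  then show ?thesis
    unfolding code_pmf_def codes_def set_Pi_pmf[OF finite_atLeastAtMost] PiE_dflt_def by blast
qed

text \<open>The product of the geometric weights is \<open>q ^ (sum s {1..n} - n)\<close> over a
  normalisation common to all codes, and \<open>q < 1\<close>.\<close>

lemma pmf_code_pmf_mono:
  assumes "0 < q" "q < 1" "s \<in> codes n" "t \<in> codes n" "sum t {1..n} \<le> sum s {1..n}"
  shows "pmf (code_pmf q n) s \<le> pmf (code_pmf q n) t"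
proof -
  define Z where "Z = (\<Prod>j\<in>{1..n}. \<Sum>k<j. q ^ k)"
  have Z: "Z \<ge> 0" unfolding Z_def using assms by (intro prod_nonneg sum_nonneg) auto
  have pmf: "pmf (code_pmf q n) s = q ^ (sum s {1..n} - n) / Z" if "s \<in> codes n" for s
  proof -
    have s: "s j \<in> {1..j}" if "j \<in> {1..n}" for j
      using \<open>s \<in> codes n\<close> that by (auto simp: codes_def PiE_dflt_def)
    have "s j = 0" if "j \<notin> {1..n}" for j
      using \<open>s \<in> codes n\<close> that unfolding codes_def PiE_dflt_def by blast
    then have "pmf (code_pmf q n) s = (\<Prod>j\<in>{1..n}. pmf (trunc_geom q j) (s j))"
      unfolding code_pmf_def by (intro pmf_Pi') auto
    also have "\<dots> = (\<Prod>j\<in>{1..n}. q ^ (s j - 1) / (\<Sum>k<j. q ^ k))"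
      by (rule prod.cong) (use s assms(1) in \<open>auto simp: pmf_trunc_geom\<close>)
    also have "\<dots> = q ^ (\<Sum>j\<in>{1..n}. s j - 1) / Z"
      by (simp add: prod_dividef power_sum Z_def)
    \<comment> \<open>Every entry is at least 1, so truncated subtraction passes through the
      sum.\<close>
    also have "(\<Sum>j\<in>{1..n}. s j - 1) = sum s {1..n} - n"
      using s by (subst sum_subtractf_nat) auto
    finally show ?thesis .
  qed
  show ?thesis unfolding pmf[OF assms(3)] pmf[OF assms(4)]
    using Z assms by (intro divide_right_mono power_decreasing) auto
qed

section \<open>Couplings of the code law with itself\<close>

text \<open>If the proposed swap is made, \<open>r\<close> and the permutation are relabelled
  together and the length is unchanged. If the code stays, then \<open>p b < p a\<close> whenever
  \<open>a\<close> and \<open>b\<close> are both in \<open>F\<close>, and exchanging them in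
  \<open>r\<close> alone does no harm.\<close>

lemma coupling_adjacent_transpose:
  assumes q: "0 < q" "q < 1" and B: "B \<subseteq> {1..n}" and inj: "inj_on r {1..n}"
    and ab: "(a, b) \<in> inversions n r"
    and adj: "\<And>c. c \<in> {1..n} \<Longrightarrow> \<not> (r b < r c \<and> r c < r a)"
  shows "rel_pmf (\<lambda>x z. high B C x = high B C z \<and>
      longest (high B C x) r (insert_perm x n) \<le>
      longest (high B C z) (r \<circ> Transposition.transpose a b) (insert_perm z n))
    (code_pmf q n) (code_pmf q n)"
proof -
  let ?s = "Transposition.transpose a b"
  have ab': "a \<in> {1..n}" "b \<in> {1..n}" "a < b" using ab by (auto simp: inversions_def)
  define S where "S x = insert_code n (insert_perm x n \<circ> ?s)" for x
  \<comment> \<open>This condition is invariant under \<open>S\<close>, which makes \<open>T\<close>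
    an involution. It does not ask for \<open>p a < p b\<close>, so the reverse swap is proposed as
    well, as stationarity requires.\<close>
  define good where
    "good x \<longleftrightarrow> x \<in> codes n \<and> a \<in> high B C x \<and> b \<in> high B C x \<and> high B C (S x) = high B C x" for x
  define T where "T x = (if good x then S x else x)" for x
  have S_codes: "S x \<in> codes n" for x unfolding S_def by (rule insert_code_in_codes)
  have perm_S: "insert_perm (S x) n = insert_perm x n \<circ> ?s" if "x \<in> codes n" for x
    unfolding S_def using that ab'
    by (intro insert_perm_insert_code permutes_compose[OF permutes_swap_id] insert_perm_codes)
  have SS: "S (S x) = x" if "x \<in> codes n" for x
    unfolding S_def[of "S x"] perm_S[OF that] by (simp add: comp_assoc insert_code_insert_perm that)
  have T: "T (T x) = x" for x
    using SS[of x] S_codes[of x] by (auto simp: T_def good_def)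
  have fin: "finite (high B C x)" for x
    by (rule finite_subset[of _ "{1..n}"]) (use B in \<open>auto simp: high_def\<close>)
  show ?thesis
  proof (rule pmf.rel_mono_strong[OF rel_pmf_metropolis[of T, OF T]])
    fix x z assume "x \<in> set_pmf (code_pmf q n)"
      and z: "z = T x \<or> z = x \<and> pmf (code_pmf q n) (T x) < pmf (code_pmf q n) x"
    then have x: "x \<in> codes n" using set_code_pmf q by blast
    let ?p = "insert_perm x n"
    have p: "inj_on ?p {1..n}"
      using insert_perm_codes[OF x] by (rule permutes_inj_on)
    show "high B C x = high B C z \<and>
      longest (high B C x) r (insert_perm x n) \<le> longest (high B C z) (r \<circ> ?s) (insert_perm z n)"
    proof (cases "good x \<and> z = T x")
      case True
      then have "z = S x" "a \<in> high B C x" "b \<in> high B C x" "high B C z = high B C x"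
        by (auto simp: T_def good_def)
      then show ?thesis using longest_transpose[OF fin] perm_S[OF x] by simp
    next
      case False
      then have zx: "z = x" using z by (auto simp: T_def)
      \<comment> \<open>Otherwise \<open>x\<close> is good and the swapped code is at least as
        likely, so the proposal could not have been rejected.\<close>
      have "?p b < ?p a" if "a \<in> high B C x" "b \<in> high B C x"
      proof (rule ccontr)
        assume "\<not> ?p b < ?p a"
        then have lt: "?p a < ?p b" using inj_onD[OF p, of a b] ab' by fastforce
        have "high B C (S x) = high B C x"
          using high_transpose[OF p B ab'(3) lt, of C] that
          by (simp add: S_def insert_code_insert_perm[OF x])
        then have "good x" using that x by (simp add: good_def)
        moreover have "pmf (code_pmf q n) x \<le> pmf (code_pmf q n) (S x)"
          using sum_insert_code_transpose[OF p ab' lt]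
          by (intro pmf_code_pmf_mono q x S_codes) (simp add: S_def insert_code_insert_perm[OF x])
        ultimately show False using False z by (auto simp: T_def)
      qed
      then show ?thesis unfolding zx
        by (intro conjI refl longest_mono[OF fin] opposed_sets_adjacent_transpose[OF inj ab adj])
           (use B in \<open>auto simp: high_def\<close>)
    qed
  qed
qed

lemma coupling_sort:
  assumes q: "0 < q" "q < 1" and B: "B \<subseteq> {1..n}" and "inj_on r {1..n}"
  shows "rel_pmf (\<lambda>x z. high B C x = high B C z \<and>
      longest (high B C x) r (insert_perm x n) \<le> longest (high B C z) id (insert_perm z n))
    (code_pmf q n) (code_pmf q n)"
  using assms(4)
proof (induction "card (inversions n r)" arbitrary: r rule: less_induct)
  case less
  have fin: "finite (high B C x)" for x
    by (rule finite_subset[of _ "{1..n}"]) (use B in \<open>auto simp: high_def\<close>)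
  show ?case
  proof (cases "inversions n r = {}")
    case True
    \<comment> \<open>Without inversions \<open>r\<close> is increasing on \<open>{1..n}\<close>, so
      it orders \<open>F\<close> as \<open>id\<close> does and the diagonal coupling works.\<close>
    have "opposed_sets F r p \<subseteq> opposed_sets F id p" if F: "F \<subseteq> {1..n}" for F p
    proof -
      have "r i < r j" if "i \<in> F" "j \<in> F" "i < j" for i j
      proof -
        have "r i \<noteq> r j" using inj_onD[OF less.prems, of i j] that F by (metis less_irrefl subsetD)
        moreover have "(i, j) \<notin> inversions n r" using True by simp
        ultimately show ?thesis using that F by (auto simp: inversions_def)
      qed
      then show ?thesis by (fastforce simp: opposed_sets_def)
    qed
    then have "longest (high B C x) r (insert_perm x n) \<le> longest (high B C x) id (insert_perm x n)" for x
      using B by (intro longest_mono[OF fin]) (simp add: high_def subset_iff)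
    then show ?thesis by (intro rel_pmf_reflI) auto
  next
    case False
    then obtain a b where ab: "(a, b) \<in> inversions n r"
      and adj: "\<And>c. c \<in> {1..n} \<Longrightarrow> \<not> (r b < r c \<and> r c < r a)"
      using adjacent_inversion by metis
    let ?r = "r \<circ> Transposition.transpose a b"
    have swap: "Transposition.transpose a b permutes {1..n}"
      using ab by (intro permutes_swap_id) (auto simp: inversions_def)
    have "inj_on ?r {1..n}"
      by (rule comp_inj_on[OF permutes_inj_on[OF swap]]) (simp only: permutes_image[OF swap] less.prems)
    moreover have "card (inversions n ?r) < card (inversions n r)"
      by (rule psubset_card_mono[OF finite_inversions inversions_adjacent_transpose[OF less.prems ab adj]])
    ultimately have "rel_pmf (\<lambda>x z. high B C x = high B C z \<and>
      longest (high B C x) ?r (insert_perm x n) \<le> longest (high B C z) id (insert_perm z n))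
      (code_pmf q n) (code_pmf q n)" by (intro less.hyps)
    \<comment> \<open>The two couplings are glued along their common middle marginal by
      \<open>pmf.rel_compp\<close>.\<close>
    with coupling_adjacent_transpose[OF q B less.prems ab adj, of C]
    have "rel_pmf ((\<lambda>x z. high B C x = high B C z \<and>
        longest (high B C x) r (insert_perm x n) \<le> longest (high B C z) ?r (insert_perm z n)) OO
      (\<lambda>x z. high B C x = high B C z \<and>
        longest (high B C x) ?r (insert_perm x n) \<le> longest (high B C z) id (insert_perm z n)))
      (code_pmf q n) (code_pmf q n)"
      unfolding pmf.rel_compp by blast
    then show ?thesis
      by (rule pmf.rel_mono_strong) auto
  qed
qed

section \<open>Longest increasing subsequences\<close>


text \<open>Passing to a strictly larger value adds at least its own position to the set being
  counted, so ranks compare as values do.\<close>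

lemma induced_perm_less_iff:
  assumes "finite A" "i \<in> {1..card A}" "j \<in> {1..card A}"
  shows "induced_perm \<pi> A i < induced_perm \<pi> A j \<longleftrightarrow>
    \<pi> (sorted_list_of_set A ! (i - 1)) < \<pi> (sorted_list_of_set A ! (j - 1))"
proof -
  let ?x = "\<lambda>i. sorted_list_of_set A ! (i - 1)"
  have mem: "?x i \<in> A" if "i \<in> {1..card A}" for i
    using that assms(1) nth_mem[of "i - 1" "sorted_list_of_set A"] by auto
  have strict: "card {b \<in> A. \<pi> b \<le> \<pi> u} < card {b \<in> A. \<pi> b \<le> \<pi> v}"
    if "v \<in> A" "\<pi> u < \<pi> v" for u v
  proof (rule psubset_card_mono)
    show "{b \<in> A. \<pi> b \<le> \<pi> u} \<subset> {b \<in> A. \<pi> b \<le> \<pi> v}"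
    proof
      have "v \<in> {b \<in> A. \<pi> b \<le> \<pi> v}" "v \<notin> {b \<in> A. \<pi> b \<le> \<pi> u}" using that by auto
      then show "{b \<in> A. \<pi> b \<le> \<pi> u} \<noteq> {b \<in> A. \<pi> b \<le> \<pi> v}" by blast
    qed (use that in auto)
  qed (use assms(1) in simp)
  have mono: "card {b \<in> A. \<pi> b \<le> \<pi> u} \<le> card {b \<in> A. \<pi> b \<le> \<pi> v}"
    if "\<pi> u \<le> \<pi> v" for u v
    by (rule card_mono) (use assms(1) that in auto)
  show ?thesis
    using strict[of "?x j" "?x i"] mono[of "?x j" "?x i"] mem[OF assms(3)] assms(2,3)
    by (cases "\<pi> (?x i) < \<pi> (?x j)") (simp_all add: induced_perm_def)
qed

text \<open>The positions visited by a common increasing index sequence form an opposed set of the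
  same size, because \<open>\<pi>\<close> reverses \<open>p\<close> on \<open>F\<close>.\<close>

lemma LIS2_le_longest:
  assumes F: "finite F"
    and p: "\<And>a b. a \<in> F \<Longrightarrow> b \<in> F \<Longrightarrow> \<pi> a < \<pi> b \<Longrightarrow> p b < p a"
  shows "LIS2 (card F) (induced_perm \<pi> F) (induced_perm \<tau> F) \<le> longest F \<tau> p"
proof -
  let ?S = "{m. \<exists>i\<in>{1..m} \<rightarrow> {1..card F}. strict_mono_on {1..m} (\<lambda>t. induced_perm \<pi> F (i t)) \<and>
    strict_mono_on {1..m} (\<lambda>t. induced_perm \<tau> F (i t))}"
  have "m \<le> longest F \<tau> p" if m: "m \<in> ?S" for m
  proof -
    obtain i where i: "i \<in> {1..m} \<rightarrow> {1..card F}"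
      and "strict_mono_on {1..m} (\<lambda>t. induced_perm \<pi> F (i t))"
        "strict_mono_on {1..m} (\<lambda>t. induced_perm \<tau> F (i t))"
      using m by blast
    define x where "x t = sorted_list_of_set F ! (i t - 1)" for t
    have ic: "i t \<in> {1..card F}" if "t \<in> {1..m}" for t using i that by blast
    have xF: "x t \<in> F" if "t \<in> {1..m}" for t
      using ic[OF that] F nth_mem[of "i t - 1" "sorted_list_of_set F"] by (auto simp: x_def)
    have \<pi>: "\<pi> (x t) < \<pi> (x u)" and \<tau>: "\<tau> (x t) < \<tau> (x u)"
      if "t \<in> {1..m}" "u \<in> {1..m}" "t < u" for t u
    proof -
      have "induced_perm \<pi> F (i t) < induced_perm \<pi> F (i u)"
        "induced_perm \<tau> F (i t) < induced_perm \<tau> F (i u)"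
        using \<open>strict_mono_on {1..m} (\<lambda>t. induced_perm \<pi> F (i t))\<close>
          \<open>strict_mono_on {1..m} (\<lambda>t. induced_perm \<tau> F (i t))\<close> that
        unfolding strict_mono_on_def by blast+
      then show "\<pi> (x t) < \<pi> (x u)" "\<tau> (x t) < \<tau> (x u)"
        using induced_perm_less_iff[OF F ic ic] that by (auto simp: x_def)
    qed
    have "inj_on x {1..m}"
      by (rule linorder_inj_onI) (use \<pi> in \<open>fastforce\<close>)+
    then have "card (x ` {1..m}) = m" by (simp add: card_image)
    moreover have "x ` {1..m} \<in> opposed_sets F \<tau> p"
    proof -
      have "p (x u) < p (x t)" if "t \<in> {1..m}" "u \<in> {1..m}" "\<tau> (x t) < \<tau> (x u)" for t u
      proof -
        \<comment> \<open>Since \<open>\<tau>\<close> increases along the sequence, comparing its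
          values recovers the order of the indices.\<close>
        have "t < u" using \<tau>[of u t] that by (metis less_asym linorder_neqE_nat)
        then show ?thesis using p[OF xF xF \<pi>] that by blast
      qed
      then show ?thesis using xF by (auto simp: opposed_sets_def)
    qed
    ultimately show ?thesis using card_le_longest[OF F] by metis
  qed
  moreover have "LIS2 (card F) (induced_perm \<pi> F) (induced_perm \<tau> F) \<in> ?S"
    unfolding LIS2_def by (rule Max_in[OF LIS2_set(1)]) (use LIS2_set(2) in blast)
  ultimately show ?thesis by blast
qed

text \<open>For the natural order, listing an opposed set increasingly gives an increasing index
  sequence along which \<open>p\<close> falls and hence \<open>\<pi>\<close> rises.\<close>

lemma longest_le_LIS:
  assumes F: "finite F"
    and p: "\<And>a b. a \<in> F \<Longrightarrow> b \<in> F \<Longrightarrow> p b < p a \<Longrightarrow> \<pi> a < \<pi> b"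
  shows "longest F id p \<le> LIS (card F) (induced_perm \<pi> F)"
proof -
  obtain A where A: "A \<in> opposed_sets F id p" "card A = longest F id p"
    using longestE[OF F] .
  let ?F = "sorted_list_of_set F" and ?A = "sorted_list_of_set A" and ?m = "card A"
  have AF: "A \<subseteq> F" using A(1) by (auto simp: opposed_sets_def)
  then have fA: "finite A" using F finite_subset by blast
  have "\<exists>k<card F. ?F ! k = a" if "a \<in> A" for a
    using that AF F by (metis in_set_conv_nth set_sorted_list_of_set length_sorted_list_of_set subsetD)
  then obtain pos where pos: "\<And>a. a \<in> A \<Longrightarrow> pos a < card F \<and> ?F ! pos a = a"
    by metis
  \<comment> \<open>List positions start at 0, arguments of the induced permutation at 1.\<close>
  define i where "i t = pos (?A ! (t - 1)) + 1" for t
  have memA: "?A ! (t - 1) \<in> A" if "t \<in> {1..?m}" for t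
    using that fA nth_mem[of "t - 1" ?A] by auto
  have i: "i \<in> {1..?m} \<rightarrow> {1..card F}"
    using pos memA by (fastforce simp: i_def)
  have nth_i: "?F ! (i t - 1) = ?A ! (t - 1)" if "t \<in> {1..?m}" for t
    using pos[OF memA[OF that]] by (simp add: i_def)
  have less: "?A ! (t - 1) < ?A ! (u - 1)" if "t \<in> {1..?m}" "u \<in> {1..?m}" "t < u" for t u
    using that fA by (intro sorted_wrt_nth_less[OF strict_sorted_list_of_set]) auto
  have "strict_mono_on {1..?m} i"
  proof (rule strict_mono_onI)
    fix t u assume tu: "t \<in> {1..?m}" "u \<in> {1..?m}" "t < u"
    show "i t < i u"
    proof (rule ccontr)
      assume "\<not> i t < i u"
      then have "?F ! (i u - 1) \<le> ?F ! (i t - 1)"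
        using i tu F by (intro sorted_nth_mono) (force simp: Pi_iff)+
      then show False using less[OF tu] nth_i tu by simp
    qed
  qed
  moreover have "strict_mono_on {1..?m} (\<lambda>t. induced_perm \<pi> F (i t))"
  proof (rule strict_mono_onI)
    fix t u assume tu: "t \<in> {1..?m}" "u \<in> {1..?m}" "t < u"
    have "p (?A ! (u - 1)) < p (?A ! (t - 1))"
      using A(1) less[OF tu] memA tu by (auto simp: opposed_sets_def)
    then have "\<pi> (?F ! (i t - 1)) < \<pi> (?F ! (i u - 1))"
      using p memA[OF tu(1)] memA[OF tu(2)] AF nth_i tu by auto
    then show "induced_perm \<pi> F (i t) < induced_perm \<pi> F (i u)"
      using induced_perm_less_iff[OF F, of "i t" "i u"] i tu by blast
  qed
  ultimately have "?m \<in> {m. \<exists>i\<in>{1..m} \<rightarrow> {1..card F}. strict_mono_on {1..m} i \<and>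
      strict_mono_on {1..m} (\<lambda>t. induced_perm \<pi> F (i t))}" using i by blast
  then have "?m \<le> LIS (card F) (induced_perm \<pi> F)"
    unfolding LIS_def by (rule Max_ge[OF LIS_set(1)])
  then show ?thesis using A(2) by simp
qed

section \<open>The coupling of three insertion codes\<close>

text \<open>A fixed \<open>y\<close> determines the order by \<open>\<tau>\<close>. Sorting that
  order couples \<open>x\<close> with \<open>z\<close>, and the two preceding comparisons turn
  \<open>longest\<close> into \<open>LIS2\<close> and \<open>LIS\<close>.\<close>

lemma finite_coupling:
  assumes q: "0 < q" "q < 1" and B: "B \<subseteq> {1..n}"
  obtains K :: "((nat \<Rightarrow> nat) \<times> (nat \<Rightarrow> nat) \<times> (nat \<Rightarrow> nat)) pmf" where
    "map_pmf (\<lambda>(x, y, z). (x, y)) K = pair_pmf (code_pmf q n) (code_pmf q n)"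
    "map_pmf (\<lambda>(x, y, z). z) K = code_pmf q n"
    "\<And>x y z. (x, y, z) \<in> set_pmf K \<Longrightarrow> x \<in> codes n \<and> y \<in> codes n \<and> z \<in> codes n \<and>
       high B C x = high B C z \<and>
       (let F = high B C x in
         LIS2 (card F) (induced_perm (\<lambda>j. n + 1 - insert_perm x n j) F)
             (induced_perm (\<lambda>j. n + 1 - insert_perm y n j) F)
         \<le> LIS (card F) (induced_perm (\<lambda>j. n + 1 - insert_perm z n j) F))"
proof -
  let ?\<mu> = "code_pmf q n"
  define r where "r y j = n + 1 - insert_perm y n j" for y j
  define R where "R y x z \<longleftrightarrow> high B C x = high B C z \<and>
      longest (high B C x) (r y) (insert_perm x n) \<le> longest (high B C z) id (insert_perm z n)" for y x z
  have fin: "finite (high B C x)" for x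
    by (rule finite_subset[of _ "{1..n}"]) (use B in \<open>auto simp: high_def\<close>)
  have le: "insert_perm y n j \<in> {1..n}" if "y \<in> codes n" "j \<in> {1..n}" for y j
    using permutes_in_image[OF insert_perm_codes[OF that(1)], of j] that(2) by blast
  have inj: "inj_on (r y) {1..n}" if y: "y \<in> codes n" for y
  proof (rule inj_onI)
    fix i j assume *: "i \<in> {1..n}" "j \<in> {1..n}" "r y i = r y j"
    then have "insert_perm y n i = insert_perm y n j"
      using le[OF y *(1)] le[OF y *(2)] unfolding r_def atLeastAtMost_iff by linarith
    then show "i = j" using permutes_inj[OF insert_perm_codes[OF y]] by (simp add: inj_eq)
  qed
  \<comment> \<open>The implication stands inside the existential so that \<open>J\<close> can be
    chosen as a total function of \<open>y\<close>.\<close>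
  have "\<exists>J. y \<in> codes n \<longrightarrow> map_pmf fst J = ?\<mu> \<and> map_pmf snd J = ?\<mu> \<and> (\<forall>(x, z)\<in>set_pmf J. R y x z)" for y
    using coupling_sort[OF q B inj, of y C] unfolding rel_pmf.simps R_def[symmetric] by blast
  then obtain J where J: "\<And>y. y \<in> codes n \<Longrightarrow> map_pmf fst (J y) = ?\<mu>"
    "\<And>y. y \<in> codes n \<Longrightarrow> map_pmf snd (J y) = ?\<mu>"
    "\<And>y x z. y \<in> codes n \<Longrightarrow> (x, z) \<in> set_pmf (J y) \<Longrightarrow> R y x z"
    by (metis (no_types, lifting) case_prodD)
  \<comment> \<open>Given \<open>y\<close>, the pair \<open>(x, z)\<close> has the same marginals whatever \<open>y\<close> is; hence \<open>x\<close> and \<open>y\<close> are independent.\<close>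
  define K where "K = bind_pmf ?\<mu> (\<lambda>y. map_pmf (\<lambda>(x, z). (x, y, z)) (J y))"
  have supp: "set_pmf ?\<mu> = codes n" by (rule set_code_pmf[OF q(1)])
  show ?thesis
  proof
    have "map_pmf (\<lambda>(x, y, z). (x, y)) K = bind_pmf ?\<mu> (\<lambda>y. map_pmf (\<lambda>x. (x, y)) (map_pmf fst (J y)))"
      by (simp add: K_def map_bind_pmf pmf.map_comp o_def case_prod_beta)
    also have "\<dots> = bind_pmf ?\<mu> (\<lambda>y. map_pmf (\<lambda>x. (x, y)) ?\<mu>)"
      by (rule bind_pmf_cong) (simp_all add: J(1) supp)
    \<comment> \<open>\<open>K\<close> draws \<open>y\<close> first, \<open>pair_pmf\<close> draws
      \<open>x\<close> first; independent draws commute.\<close>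
    also have "\<dots> = pair_pmf ?\<mu> ?\<mu>"
      unfolding pair_pmf_def map_pmf_def by (rule bind_commute_pmf)
    finally show "map_pmf (\<lambda>(x, y, z). (x, y)) K = pair_pmf ?\<mu> ?\<mu>" .
    have "map_pmf (\<lambda>(x, y, z). z) K = bind_pmf ?\<mu> (\<lambda>y. map_pmf snd (J y))"
      by (simp add: K_def map_bind_pmf pmf.map_comp o_def case_prod_beta)
    also have "\<dots> = bind_pmf ?\<mu> (\<lambda>y. ?\<mu>)"
      by (rule bind_pmf_cong) (simp_all add: J(2) supp)
    finally show "map_pmf (\<lambda>(x, y, z). z) K = ?\<mu>" by simp
  next
    fix x y z assume "(x, y, z) \<in> set_pmf K"
    then have y: "y \<in> codes n" and xz: "(x, z) \<in> set_pmf (J y)"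
      by (auto simp: K_def supp)
    have x: "x \<in> codes n" using J(1)[OF y] xz supp by (metis fst_conv image_eqI set_map_pmf)
    have z: "z \<in> codes n" using J(2)[OF y] xz supp by (metis snd_conv image_eqI set_map_pmf)
    let ?F = "high B C x"
    have F: "?F \<subseteq> {1..n}" using B by (auto simp: high_def)
    have R: "R y x z" using J(3) y xz .
    have "LIS2 (card ?F) (induced_perm (r x) ?F) (induced_perm (r y) ?F)
        \<le> longest ?F (r y) (insert_perm x n)"
      by (rule LIS2_le_longest[OF fin]) (simp add: r_def)
    also have "\<dots> \<le> longest ?F id (insert_perm z n)"
      using R unfolding R_def by metis
    also have "\<dots> \<le> LIS (card ?F) (induced_perm (r z) ?F)"
    proof (rule longest_le_LIS[OF fin])
      fix a b assume "a \<in> ?F" "b \<in> ?F" "insert_perm z n b < insert_perm z n a"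
      then show "r z a < r z b" using le[OF z, of a] F by (force simp: r_def)
    qed
    finally show "x \<in> codes n \<and> y \<in> codes n \<and> z \<in> codes n \<and> high B C x = high B C z \<and>
       (let F = high B C x in
         LIS2 (card F) (induced_perm (\<lambda>j. n + 1 - insert_perm x n j) F)
             (induced_perm (\<lambda>j. n + 1 - insert_perm y n j) F)
         \<le> LIS (card F) (induced_perm (\<lambda>j. n + 1 - insert_perm z n j) F))"
      using x y z R by (simp add: R_def r_def[abs_def] Let_def)
  qed
qed

section \<open>Insertion processes\<close>


text \<open>The shape of the sample space: \<open>K\<close> for the coupled codes, an infinite
  product for the later insertions, and a third factor completing the triple.\<close>

lemma measure_pmf_pair_PiM:
  fixes K :: "'k pmf" and D :: "nat \<Rightarrow> 'd pmf" and R :: "'r pmf"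
  defines "T \<equiv> \<Pi>\<^sub>M m\<in>UNIV. measure_pmf (D m)"
  defines "M \<equiv> measure_pmf K \<Otimes>\<^sub>M (T \<Otimes>\<^sub>M measure_pmf R)"
  assumes J: "finite J"
  shows "measure M {\<omega> \<in> space M. fst \<omega> \<in> E \<and> (\<forall>m\<in>J. fst (snd \<omega>) m \<in> X m)} =
    measure K E * (\<Prod>m\<in>J. measure (D m) (X m))"
proof -
  interpret T: product_prob_space "\<lambda>m. measure_pmf (D m)" UNIV ..
  interpret TP: prob_space T unfolding T_def by (intro prob_space_PiM measure_pmf.prob_space_axioms)
  interpret TR: pair_prob_space T "measure_pmf R" ..
  let ?U = "{u \<in> space T. \<forall>m\<in>J. u m \<in> X m}"
  have "Measurable.pred T (\<lambda>u. u m \<in> X m)" for m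
  proof -
    have "(\<lambda>u. u m) \<in> T \<rightarrow>\<^sub>M measure_pmf (D m)"
      unfolding T_def by (rule measurable_component_singleton) simp
    then show ?thesis by (rule measurable_compose) simp
  qed
  then have U: "?U \<in> sets T"
    using J by (intro sets.sets_Collect_finite_All) (simp_all add: pred_def)
  have eq: "{\<omega> \<in> space M. fst \<omega> \<in> E \<and> (\<forall>m\<in>J. fst (snd \<omega>) m \<in> X m)} = E \<times> (?U \<times> UNIV)"
    by (auto simp: M_def space_pair_measure)
  have "emeasure M (E \<times> (?U \<times> UNIV)) = emeasure K E * emeasure (T \<Otimes>\<^sub>M measure_pmf R) (?U \<times> UNIV)"
    unfolding M_def using U by (intro TR.emeasure_pair_measure_Times) auto
  also have "emeasure (T \<Otimes>\<^sub>M measure_pmf R) (?U \<times> UNIV) = emeasure T ?U * emeasure R UNIV"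
    using U by (intro measure_pmf.emeasure_pair_measure_Times) auto
  also have "emeasure R UNIV = 1" by simp
  also have "emeasure T ?U = (\<Prod>m\<in>J. emeasure (D m) (X m))"
    unfolding T_def by (rule T.emeasure_PiM_Collect) (use J in auto)
  also have "emeasure K E * ((\<Prod>m\<in>J. emeasure (D m) (X m)) * 1) =
      ennreal (measure K E * (\<Prod>m\<in>J. measure (D m) (X m)))"
    by (simp add: measure_pmf.emeasure_eq_measure prod_ennreal ennreal_mult prod_nonneg)
  finally show ?thesis
    unfolding eq by (rule measure_eq_emeasure_eq_ennreal[rotated]) (simp add: prod_nonneg)
qed

text \<open>Indices in \<open>A\<close> are read off \<open>K\<close>, every other index off its own
  coordinate. Injectivity of \<open>c\<close> keeps these coordinates distinct, so the joint law
  factorises. The index type is general to serve one process as well as a pair.\<close>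

lemma joint_law_combined:
  fixes K :: "'k pmf" and D :: "nat \<Rightarrow> 'd pmf" and R :: "'r pmf"
    and A :: "'i set" and G :: "'i \<Rightarrow> nat pmf" and v :: "'k \<Rightarrow> 'i \<Rightarrow> nat" and w :: "'i \<Rightarrow> 'd \<Rightarrow> nat" and c :: "'i \<Rightarrow> nat"
  defines "M \<equiv> measure_pmf K \<Otimes>\<^sub>M ((\<Pi>\<^sub>M m\<in>UNIV. measure_pmf (D m)) \<Otimes>\<^sub>M measure_pmf R)"
  defines "W \<equiv> \<lambda>j \<omega>. if j \<in> A then v (fst \<omega>) j else w j (fst (snd \<omega>) (c j))"
  assumes A: "finite A"
    and K: "\<And>S. measure K {k. \<forall>j\<in>A. v k j \<in> S j} = (\<Prod>j\<in>A. measure (G j) (S j))"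
    and c: "inj_on c I" and w: "\<And>j. j \<in> I - A \<Longrightarrow> map_pmf (w j) (D (c j)) = G j"
    and J: "finite J" "J \<subseteq> I"
  shows "measure M {\<omega> \<in> space M. \<forall>j\<in>J. W j \<omega> \<in> S j} = (\<Prod>j\<in>J. measure (G j) (S j))"
proof -
  \<comment> \<open>Indices of \<open>A\<close> outside \<open>J\<close> get the trivial constraint,
    because the law of \<open>K\<close> is given for all of \<open>A\<close> at once.\<close>
  define S' where "S' j = (if j \<in> J then S j else UNIV)" for j
  define X where "X m = (let j = the_inv_into (J - A) c m in w j -` S j)" for m
  have inj: "inj_on c (J - A)" by (rule inj_on_subset[OF c]) (use J in auto)
  have X: "X (c j) = w j -` S j" if "j \<in> J - A" for j
    using that inj by (simp add: X_def the_inv_into_f_f)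
  have "{\<omega> \<in> space M. \<forall>j\<in>J. W j \<omega> \<in> S j} = {\<omega> \<in> space M.
      fst \<omega> \<in> {k. \<forall>j\<in>A. v k j \<in> S' j} \<and> (\<forall>m\<in>c ` (J - A). fst (snd \<omega>) m \<in> X m)}"
    (is "?L = ?R")
  proof -
    have "(\<forall>j\<in>J. W j \<omega> \<in> S j) \<longleftrightarrow> (\<forall>j\<in>A. v (fst \<omega>) j \<in> S' j) \<and>
        (\<forall>j\<in>J - A. fst (snd \<omega>) (c j) \<in> X (c j))" for \<omega>
      using X by (auto simp: W_def S'_def)
    then show ?thesis by auto
  qed
  then have "measure M ?L = measure M ?R" by simp
  also have "\<dots> = measure K {k. \<forall>j\<in>A. v k j \<in> S' j} * (\<Prod>m\<in>c ` (J - A). measure (D m) (X m))"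
    unfolding M_def by (rule measure_pmf_pair_PiM) (use J in simp)
  also have "(\<Prod>m\<in>c ` (J - A). measure (D m) (X m)) = (\<Prod>j\<in>J - A. measure (G j) (S j))"
    unfolding prod.reindex[OF inj] o_def
  proof (rule prod.cong)
    fix j assume j: "j \<in> J - A"
    then have "G j = map_pmf (w j) (D (c j))" using w J by auto
    then show "measure (D (c j)) (X (c j)) = measure (G j) (S j)" by (simp add: X[OF j])
  qed simp
  also have "measure K {k. \<forall>j\<in>A. v k j \<in> S' j} = (\<Prod>j\<in>A \<inter> J. measure (G j) (S j))"
    unfolding K prod.inter_restrict[OF A] by (rule prod.cong) (simp_all add: S'_def)
  also have "(\<Prod>j\<in>A \<inter> J. measure (G j) (S j)) * (\<Prod>j\<in>J - A. measure (G j) (S j)) =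
      (\<Prod>j\<in>J. measure (G j) (S j))"
    using J(1) by (subst prod.union_disjoint[symmetric]) (auto intro!: prod.cong)
  finally show ?thesis .
qed

text \<open>Singleton sets \<open>J\<close> identify the marginals, after which the product formula
  is independence.\<close>

lemma (in prob_space) indep_vars_count_space:
  fixes G :: "'i \<Rightarrow> 'b pmf" and W :: "'i \<Rightarrow> 'a \<Rightarrow> 'b"
  assumes meas: "\<And>i. i \<in> I \<Longrightarrow> W i \<in> M \<rightarrow>\<^sub>M count_space (N i)"
    and joint: "\<And>J S. finite J \<Longrightarrow> J \<subseteq> I \<Longrightarrow>
      prob {\<omega> \<in> space M. \<forall>j\<in>J. W j \<omega> \<in> S j} = (\<Prod>j\<in>J. measure (G j) (S j))"
  shows "indep_vars (\<lambda>i. count_space (N i)) W I"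
  unfolding indep_vars_def2
proof (intro conjI ballI indep_setsI)
  show "W i \<in> M \<rightarrow>\<^sub>M count_space (N i)" if "i \<in> I" for i
    using that by (rule meas)
  show "{W i -` A \<inter> space M | A. A \<in> sets (count_space (N i))} \<subseteq> events" if "i \<in> I" for i
    using that measurable_sets[OF meas] by blast
next
  fix A J assume J: "J \<noteq> {}" "J \<subseteq> I" "finite J"
    and A: "\<forall>j\<in>J. A j \<in> {W j -` A \<inter> space M | A. A \<in> sets (count_space (N j))}"
  from A obtain S where S: "\<And>j. j \<in> J \<Longrightarrow> A j = W j -` S j \<inter> space M" by simp metis
  have "prob (A j) = measure (G j) (S j)" if "j \<in> J" for j
  proof -
    have "A j = {\<omega> \<in> space M. \<forall>i\<in>{j}. W i \<omega> \<in> S i}" using S[OF that] by auto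
    then show ?thesis using joint[of "{j}" S] that J by auto
  qed
  moreover have "(\<Inter>j\<in>J. A j) = {\<omega> \<in> space M. \<forall>j\<in>J. W j \<omega> \<in> S j}" using S J(1) by auto
  ultimately show "prob (\<Inter>j\<in>J. A j) = (\<Prod>j\<in>J. prob (A j))"
    using joint[of J S] J by simp
qed

lemma measurable_count_space_subset:
  assumes "f \<in> M \<rightarrow>\<^sub>M count_space UNIV" "\<And>x. x \<in> space M \<Longrightarrow> f x \<in> A"
  shows "f \<in> M \<rightarrow>\<^sub>M count_space A"
proof -
  have "f \<in> M \<rightarrow>\<^sub>M restrict_space (count_space UNIV) A"
    by (rule measurable_restrict_space2) (use assms in auto)
  then show ?thesis by (simp add: restrict_count_space)
qed

lemma (in prob_space) mallows_process_insert_perm: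
  assumes s: "\<And>\<omega> i. i \<ge> 1 \<Longrightarrow> s i \<omega> \<in> {1..i}"
    and meas: "\<And>i. i \<ge> 1 \<Longrightarrow> s i \<in> M \<rightarrow>\<^sub>M count_space UNIV"
    and joint: "\<And>J S. finite J \<Longrightarrow> J \<subseteq> {1..} \<Longrightarrow>
      prob {\<omega> \<in> space M. \<forall>j\<in>J. s j \<omega> \<in> S j} = (\<Prod>j\<in>J. measure (trunc_geom q j) (S j))"
    and q: "0 < q"
  shows "mallows_process q M (\<lambda>n \<omega>. insert_perm (\<lambda>i. s i \<omega>) n)"
  unfolding mallows_process_def
proof (intro conjI allI impI ballI)
  show "insert_perm (\<lambda>i. s i \<omega>) n permutes {1..n}" for n \<omega>
    by (rule insert_perm_permutes) (use s in auto)
  have "indep_vars (\<lambda>n. count_space {1..n}) s {1..}"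
  proof (rule indep_vars_count_space[where G = "trunc_geom q"])
    fix i :: nat assume "i \<in> {1..}"
    then show "s i \<in> M \<rightarrow>\<^sub>M count_space {1..i}"
      using s by (intro measurable_count_space_subset[OF meas]) auto
  qed (rule joint)
  then show "indep_vars (\<lambda>n. count_space {1..n}) (\<lambda>n \<omega>. insert_perm (\<lambda>i. s i \<omega>) n n) {1..}"
    by (rule indep_vars_cong[THEN iffD1, rotated -1]) (auto simp: insert_perm_diag)
  show "prob {\<omega> \<in> space M. insert_perm (\<lambda>i. s i \<omega>) n n = j} = q ^ (j - 1) / (\<Sum>k<n. q ^ k)"
    if "n \<ge> 1" "j \<in> {1..n}" for n j
    using joint[of "{n}" "\<lambda>_. {j}"] that q
    by (simp add: insert_perm_diag measure_pmf_single pmf_trunc_geom)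
  show "insert_perm (\<lambda>i. s i \<omega>) n i =
      (if insert_perm (\<lambda>i. s i \<omega>) (n - 1) i < insert_perm (\<lambda>i. s i \<omega>) n n
       then insert_perm (\<lambda>i. s i \<omega>) (n - 1) i else insert_perm (\<lambda>i. s i \<omega>) (n - 1) i + 1)"
    if "n \<ge> 2" "i \<in> {1..<n}" for n i \<omega>
    using that by (cases n) auto
qed

text \<open>Measurability is stated for one block \<open>b\<close> of coordinates, so that
  independence of blocks passes to the permutations built from them.\<close>

lemma measurable_insert_perm:
  "(\<lambda>f. insert_perm (\<lambda>i. f (b, i)) n) \<in>
     (\<Pi>\<^sub>M z\<in>{b} \<times> {1..}. count_space {1..snd z}) \<rightarrow>\<^sub>M count_space {s. s permutes {1..n}}"
  (is "_ \<in> ?P \<rightarrow>\<^sub>M _")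
proof -
  have "(\<lambda>f. insert_perm (\<lambda>i. f (b, i)) n) \<in> ?P \<rightarrow>\<^sub>M count_space UNIV"
  proof (induction n)
    case (Suc n)
    define h where "h v p i = (if i = Suc n then v else if i \<in> {1..n} then
      (if p i < v then p i else p i + 1) else i)" for v i :: nat and p
    have "(\<lambda>f. h (f (b, Suc n)) (insert_perm (\<lambda>i. f (b, i)) n)) \<in> ?P \<rightarrow>\<^sub>M count_space UNIV"
    \<comment> \<open>For each of the finitely many inserted values \<open>v\<close>, the step is a
      map out of a discrete space.\<close>
    proof (rule measurable_compose_countable'[where I = "{1..Suc n}"
          and f = "\<lambda>v f. h v (insert_perm (\<lambda>i. f (b, i)) n)"])
      show "(\<lambda>f. f (b, Suc n)) \<in> ?P \<rightarrow>\<^sub>M count_space {1..Suc n}"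
        using measurable_component_singleton[of "(b, Suc n)" "{b} \<times> {1..}" "\<lambda>z. count_space {1..snd z}"]
        by simp
      show "(\<lambda>f. h v (insert_perm (\<lambda>i. f (b, i)) n)) \<in> ?P \<rightarrow>\<^sub>M count_space UNIV" for v
        by (rule measurable_compose[OF Suc.IH]) simp
    qed simp
    then show ?case by (simp add: h_def[abs_def])
  qed simp
  moreover have "insert_perm (\<lambda>i. f (b, i)) n permutes {1..n}" if "f \<in> space ?P" for f
    by (rule insert_perm_permutes) (use that in \<open>auto simp: space_PiM PiE_iff\<close>)
  ultimately show ?thesis
    by (rule measurable_count_space_subset[where A = "{s. s permutes {1..n}}", simplified mem_Collect_eq])
qed

text \<open>The two processes are measurable functions of disjoint blocks of one independent
  family.\<close>

lemma (in prob_space) indep_processes_insert_perm: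
  assumes "indep_vars (\<lambda>z. count_space {1..snd z}) W (UNIV \<times> {1..})"
  shows "indep_processes M (\<lambda>n \<omega>. insert_perm (\<lambda>i. W (True, i) \<omega>) n)
    (\<lambda>n \<omega>. insert_perm (\<lambda>i. W (False, i) \<omega>) n)"
proof -
  define \<Phi> where "\<Phi> b f = (\<lambda>n\<in>{1..}. insert_perm (\<lambda>i. f (b, i)) n)" for b :: bool and f :: "bool \<times> nat \<Rightarrow> nat"
  define Z where "Z b \<omega> = (\<lambda>z\<in>{b} \<times> {1..}. W z \<omega>)" for b \<omega>
  have \<Phi>: "\<Phi> b \<in> (\<Pi>\<^sub>M z\<in>{b} \<times> {1..}. count_space {1..snd z}) \<rightarrow>\<^sub>M path_space" for b
    unfolding \<Phi>_def path_space_def by (rule measurable_restrict) (rule measurable_insert_perm)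
  have "indep_var (\<Pi>\<^sub>M z\<in>{True} \<times> {1..}. count_space {1..snd z}) (Z True)
      (\<Pi>\<^sub>M z\<in>{False} \<times> {1..}. count_space {1..snd z}) (Z False)"
    unfolding Z_def by (rule indep_var_restrict[OF assms]) auto
  then have "indep_var path_space (\<Phi> True \<circ> Z True) path_space (\<Phi> False \<circ> Z False)"
    by (rule indep_var_compose[OF _ \<Phi> \<Phi>])
  moreover have "(\<Phi> b \<circ> Z b) = (\<lambda>\<omega>. \<lambda>n\<in>{1..}. insert_perm (\<lambda>i. W (b, i) \<omega>) n)" for b
    unfolding \<Phi>_def Z_def o_def by (intro ext restrict_ext insert_perm_cong) auto
  ultimately show ?thesis by (simp add: indep_processes_def)
qed


text \<open>Both factors are cut down to their supports, which supplies the countability that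
  \<open>measure_pmf_prob_product\<close> requires.\<close>

lemma measure_pair_pmf_Times:
  "measure (pair_pmf p p') (X \<times> Y) = measure p X * measure p' Y"
proof -
  have "measure (pair_pmf p p') (X \<times> Y) = measure (pair_pmf p p') ((X \<times> Y) \<inter> set_pmf (pair_pmf p p'))"
    by (simp only: measure_Int_set_pmf)
  also have "(X \<times> Y) \<inter> set_pmf (pair_pmf p p') = (X \<inter> set_pmf p) \<times> (Y \<inter> set_pmf p')"
    by auto
  also have "measure (pair_pmf p p') \<dots> = measure p (X \<inter> set_pmf p) * measure p' (Y \<inter> set_pmf p')"
    by (rule measure_pmf_prob_product) auto
  finally show ?thesis by (simp only: measure_Int_set_pmf)
qed

lemma prob_space_pmf_pair_PiM:
  "prob_space (measure_pmf K \<Otimes>\<^sub>M ((\<Pi>\<^sub>M m\<in>UNIV. measure_pmf (D m)) \<Otimes>\<^sub>M measure_pmf R))"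
proof -
  interpret T: prob_space "\<Pi>\<^sub>M m\<in>UNIV. measure_pmf (D m)"
    by (intro prob_space_PiM measure_pmf.prob_space_axioms)
  interpret TR: pair_prob_space "\<Pi>\<^sub>M m\<in>UNIV. measure_pmf (D m)" "measure_pmf R" ..
  interpret KTR: pair_prob_space "measure_pmf K"
    "(\<Pi>\<^sub>M m\<in>UNIV. measure_pmf (D m)) \<Otimes>\<^sub>M measure_pmf R" ..
  show ?thesis by (rule KTR.prob_space_axioms)
qed

lemma measurable_combined:
  fixes v :: "'k \<Rightarrow> 'i \<Rightarrow> nat" and w :: "'i \<Rightarrow> 'd \<Rightarrow> nat"
  shows "(\<lambda>\<omega>. if j \<in> A then v (fst \<omega>) j else w j (fst (snd \<omega>) (c j))) \<in>
    measure_pmf K \<Otimes>\<^sub>M ((\<Pi>\<^sub>M m\<in>UNIV. measure_pmf (D m)) \<Otimes>\<^sub>M measure_pmf R) \<rightarrow>\<^sub>M count_space UNIV"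
    (is "_ \<in> ?M \<rightarrow>\<^sub>M _")
proof (cases "j \<in> A")
  case True
  have "fst \<in> ?M \<rightarrow>\<^sub>M measure_pmf K" by simp
  then have "(\<lambda>\<omega>. v (fst \<omega>) j) \<in> ?M \<rightarrow>\<^sub>M count_space UNIV"
    by (rule measurable_compose) simp
  then show ?thesis using True by simp
next
  case False
  have "(\<lambda>u. u (c j)) \<in> (\<Pi>\<^sub>M m\<in>UNIV. measure_pmf (D m)) \<rightarrow>\<^sub>M measure_pmf (D (c j))"
    by (rule measurable_component_singleton) simp
  then have "(\<lambda>\<omega>. fst (snd \<omega>) (c j)) \<in> ?M \<rightarrow>\<^sub>M measure_pmf (D (c j))"
    by (rule measurable_compose[rotated]) (rule measurable_compose[OF measurable_snd measurable_fst])
  then have "(\<lambda>\<omega>. w j (fst (snd \<omega>) (c j))) \<in> ?M \<rightarrow>\<^sub>M count_space UNIV"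
    by (rule measurable_compose) simp
  then show ?thesis using False by simp
qed

text \<open>The conclusion involves insertions up to time \<open>n\<close> only. These follow the
  coupled codes, and fresh independent insertions continue the processes.\<close>

theorem lemma2p14:
  fixes n :: nat and B :: "nat set" and q C :: real
  assumes "n \<ge> 1"
    and "B \<subseteq> {1..n}" and "B \<noteq> {}" and "\<exists>a b. B = {a..b}"
    and "0 < q" and "q < 1"
    and "C > 0"
  shows "\<exists>(M :: ((nat \<Rightarrow> nat \<Rightarrow> nat) \<times> (nat \<Rightarrow> nat \<Rightarrow> nat) \<times> (nat \<Rightarrow> nat \<Rightarrow> nat)) measure)
            pbar p' phat.
    prob_space M \<and>
    mallows_process q M pbar \<and> mallows_process q M p' \<and> mallows_process q M phat \<and>
    indep_processes M pbar p' \<and>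
    (\<forall>\<omega>\<in>space M.
       let \<pi> = (\<lambda>j. n + 1 - pbar n \<omega> j);
           \<tau> = (\<lambda>j. n + 1 - p' n \<omega> j);
           \<pi>hat = (\<lambda>j. n + 1 - phat n \<omega> j);
           Fbar = {j \<in> B. real (pbar j \<omega> j) > C};
           Fhat = {j \<in> B. real (phat j \<omega> j) > C}
       in Fbar = Fhat \<and>
          LIS2 (card Fbar) (induced_perm \<pi> Fbar) (induced_perm \<tau> Fbar)
            \<le> LIS (card Fbar) (induced_perm \<pi>hat Fbar))"
proof -
  let ?\<mu> = "code_pmf q n" and ?G = "trunc_geom q"
  note B = \<open>B \<subseteq> {1..n}\<close> and q = \<open>0 < q\<close> \<open>q < 1\<close>
  obtain K :: "((nat \<Rightarrow> nat) \<times> (nat \<Rightarrow> nat) \<times> (nat \<Rightarrow> nat)) pmf" where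
    K1: "map_pmf (\<lambda>(x, y, z). (x, y)) K = pair_pmf ?\<mu> ?\<mu>" and
    K2: "map_pmf (\<lambda>(x, y, z). z) K = ?\<mu>" and
    K3: "\<And>x y z. (x, y, z) \<in> set_pmf K \<Longrightarrow> x \<in> codes n \<and> y \<in> codes n \<and> z \<in> codes n \<and>
       high B C x = high B C z \<and>
       (let F = high B C x in
         LIS2 (card F) (induced_perm (\<lambda>j. n + 1 - insert_perm x n j) F)
             (induced_perm (\<lambda>j. n + 1 - insert_perm y n j) F)
         \<le> LIS (card F) (induced_perm (\<lambda>j. n + 1 - insert_perm z n j) F))"
    using finite_coupling[OF q B, of C] by blast

  \<comment> \<open>The triple of codes is packed into a single function, indexed by 0, 1, 2, to fit
    the first component of the sample type.\<close>
  define K' where "K' = map_pmf (\<lambda>(x, y, z) t. if t = (0::nat) then x else if t = 1 then y else z) K"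
  \<comment> \<open>The conclusion is required at every sample point, so values off the support of \<open>K'\<close> are replaced.\<close>
  define cl where "cl k = (if k \<in> set_pmf K' then k else (SOME k. k \<in> set_pmf K'))" for k
  have cl_in: "cl k \<in> set_pmf K'" for k
    using someI_ex[of "\<lambda>k. k \<in> set_pmf K'"] set_pmf_not_empty[of K'] by (auto simp: cl_def)
  have cl_cases: "\<exists>x y z. (x, y, z) \<in> set_pmf K \<and> cl k 0 = x \<and> cl k 1 = y \<and> cl k 2 = z \<and>
      (\<forall>t. cl k t \<in> {x, y, z})" for k
    using cl_in[of k] by (fastforce simp: K'_def)
  have supp: "cl k t \<in> codes n" for k t
  proof -
    obtain x y z where "(x, y, z) \<in> set_pmf K" "cl k t \<in> {x, y, z}"
      using cl_cases by metis
    then show ?thesis using K3[of x y z] by blast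
  qed
  have coupled: "high B C (cl k 0) = high B C (cl k 2)"
    "LIS2 (card (high B C (cl k 0)))
       (induced_perm (\<lambda>j. n + 1 - insert_perm (cl k 0) n j) (high B C (cl k 0)))
       (induced_perm (\<lambda>j. n + 1 - insert_perm (cl k 1) n j) (high B C (cl k 0)))
     \<le> LIS (card (high B C (cl k 0)))
       (induced_perm (\<lambda>j. n + 1 - insert_perm (cl k 2) n j) (high B C (cl k 0)))" for k
    using cl_cases[of k] K3 unfolding Let_def by metis+
  \<comment> \<open>On the support \<open>cl\<close> is the identity, so the laws are
    unaffected.\<close>
  have cl_map: "map_pmf (\<lambda>k. f (cl k)) K' = map_pmf f K'" for f :: "_ \<Rightarrow> 'z"
    by (rule map_pmf_cong) (simp_all add: cl_def)
  have law2: "map_pmf (\<lambda>k. (cl k 0, cl k 1)) K' = pair_pmf ?\<mu> ?\<mu>"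
    unfolding cl_map[of "\<lambda>k. (k 0, k 1)"]
    unfolding K1[symmetric] K'_def pmf.map_comp
    by (rule map_pmf_cong) auto
  have "map_pmf (\<lambda>k. cl k 0) K' = map_pmf fst (map_pmf (\<lambda>k. (cl k 0, cl k 1)) K')"
    by (simp add: pmf.map_comp o_def)
  then have law_0: "map_pmf (\<lambda>k. cl k 0) K' = ?\<mu>" by (simp only: law2 map_fst_pair_pmf)
  have "map_pmf (\<lambda>k. cl k 1) K' = map_pmf snd (map_pmf (\<lambda>k. (cl k 0, cl k 1)) K')"
    by (simp add: pmf.map_comp o_def)
  then have law_1: "map_pmf (\<lambda>k. cl k 1) K' = ?\<mu>" by (simp only: law2 map_snd_pair_pmf)
  have law_2: "map_pmf (\<lambda>k. cl k 2) K' = ?\<mu>"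
    unfolding cl_map[of "\<lambda>k. k 2"]
    unfolding K2[symmetric] K'_def pmf.map_comp
    by (rule map_pmf_cong) auto

  \<comment> \<open>Coordinate \<open>2 * i + e\<close> of the infinite product carries the insertion at time \<open>i > n\<close>, with \<open>e = 0\<close>
    for \<open>pbar\<close> and \<open>phat\<close>, and \<open>e = 1\<close> for \<open>p'\<close>.\<close>
  define D where "D m = map_pmf (\<lambda>j (_ :: nat). j) (?G (m div 2))" for m :: nat
  \<comment> \<open>\<open>D\<close> wraps each value as a constant function, to fit the sample
    type, and \<open>w\<close> reads it at argument 0. The fallback value 1 keeps the range correct
    at every sample point.\<close>
  define w where "w i d = (if d 0 \<in> {1..i} then d 0 else 1)" for i :: nat and d :: "nat \<Rightarrow> nat"
  have w_law: "map_pmf (w i) (D (2 * i + e)) = ?G i" if "i \<ge> 1" "e < 2" for i e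
  proof -
    have "(2 * i + e) div 2 = i" using that by simp
    then have "map_pmf (w i) (D (2 * i + e)) = map_pmf (\<lambda>j. w i (\<lambda>_. j)) (?G i)"
      by (simp add: D_def pmf.map_comp o_def)
    also have "\<dots> = map_pmf (\<lambda>j. j) (?G i)"
      by (rule map_pmf_cong) (use that q in \<open>auto simp: set_trunc_geom w_def\<close>)
    finally show ?thesis by simp
  qed
  \<comment> \<open>A point mass fills the third component of the sample type.\<close>
  define R :: "(nat \<Rightarrow> nat \<Rightarrow> nat) pmf" where "R = return_pmf (\<lambda>_ _. 0)"
  define M where "M = measure_pmf K' \<Otimes>\<^sub>M ((\<Pi>\<^sub>M m\<in>UNIV. measure_pmf (D m)) \<Otimes>\<^sub>M measure_pmf R)"
  interpret M: prob_space M unfolding M_def by (rule prob_space_pmf_pair_PiM)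

  \<comment> \<open>\<open>t\<close> selects the code up to time \<open>n\<close>, \<open>e\<close>
    the coordinates afterwards; \<open>pbar\<close>, \<open>p'\<close> and \<open>phat\<close> are
    \<open>(0, 0)\<close>, \<open>(1, 1)\<close> and \<open>(2, 0)\<close>.\<close>
  define W where "W t e i \<omega> = (if i \<in> {1..n} then cl (fst \<omega>) t i else w i (fst (snd \<omega>) (2 * i + e)))"
    for t e i :: nat and \<omega> :: "(nat \<Rightarrow> nat \<Rightarrow> nat) \<times> (nat \<Rightarrow> nat \<Rightarrow> nat) \<times> (nat \<Rightarrow> nat \<Rightarrow> nat)"
  have W_range: "W t e i \<omega> \<in> {1..i}" if "i \<ge> 1" for t e i \<omega>
  proof (cases "i \<in> {1..n}")
    case True
    then show ?thesis using supp[of "fst \<omega>" t] unfolding W_def codes_def PiE_dflt_def by auto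
  qed (use that in \<open>auto simp: W_def w_def\<close>)
  have W_meas: "W t e i \<in> M \<rightarrow>\<^sub>M count_space UNIV" for t e i
    unfolding M_def W_def by (rule measurable_combined)
  have mallows: "mallows_process q M (\<lambda>n \<omega>. insert_perm (\<lambda>i. W t e i \<omega>) n)"
    if law: "map_pmf (\<lambda>k. cl k t) K' = ?\<mu>" and e: "e < 2" for t e
  proof (rule M.mallows_process_insert_perm[OF W_range W_meas _ q(1)])
    have fin: "measure K' {k. \<forall>j\<in>{1..n}. cl k t j \<in> S j} = (\<Prod>j\<in>{1..n}. measure (?G j) (S j))" for S
    proof -
      have "measure K' {k. \<forall>j\<in>{1..n}. cl k t j \<in> S j} = measure (map_pmf (\<lambda>k. cl k t) K') (Pi {1..n} S)"
        unfolding measure_map_pmf by (rule arg_cong[where f = "measure K'"]) (auto simp: Pi_iff)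
      then show ?thesis unfolding law code_pmf_def by (simp add: measure_Pi_pmf_Pi)
    qed
    fix J :: "nat set" and S assume "finite J" "J \<subseteq> {1..}"
    then show "M.prob {\<omega> \<in> space M. \<forall>j\<in>J. W t e j \<omega> \<in> S j} = (\<Prod>j\<in>J. measure (?G j) (S j))"
      unfolding M_def W_def
      by (intro joint_law_combined[where I = "{1..}" and v = "\<lambda>k. cl k t"] fin)
         (use w_law e in \<open>auto simp: inj_on_def\<close>)
  qed auto

  have "indep_processes M (\<lambda>n \<omega>. insert_perm (\<lambda>i. W 0 0 i \<omega>) n) (\<lambda>n \<omega>. insert_perm (\<lambda>i. W 1 1 i \<omega>) n)"
  proof -
    \<comment> \<open>For \<open>pbar\<close> and \<open>p'\<close> the two selectors coincide, so
      one number serves as code index and as parity.\<close>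
    define t where "t z = (if fst z then 0 else 1 :: nat)" for z :: "bool \<times> nat"
    define V where "V z \<omega> = W (t z) (t z) (snd z) \<omega>" for z \<omega>
    have V: "V z \<omega> = (if z \<in> UNIV \<times> {1..n} then cl (fst \<omega>) (t z) (snd z)
        else w (snd z) (fst (snd \<omega>) (2 * snd z + t z)))" for z \<omega>
      by (auto simp: V_def W_def mem_Times_iff)
    have fin: "measure K' {k. \<forall>z\<in>UNIV \<times> {1..n}. cl k (t z) (snd z) \<in> S z} =
        (\<Prod>z\<in>UNIV \<times> {1..n}. measure (?G (snd z)) (S z))" for S
    proof -
      let ?P = "\<lambda>b. Pi {1..n} (\<lambda>j. S (b, j))"
      have "{k. \<forall>z\<in>UNIV \<times> {1..n}. cl k (t z) (snd z) \<in> S z} =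
          (\<lambda>k. (cl k 0, cl k 1)) -` (?P True \<times> ?P False)"
        by (auto simp: t_def UNIV_bool)
      then have "measure K' {k. \<forall>z\<in>UNIV \<times> {1..n}. cl k (t z) (snd z) \<in> S z} =
          measure (map_pmf (\<lambda>k. (cl k 0, cl k 1)) K') (?P True \<times> ?P False)"
        by (simp only: measure_map_pmf)
      also have "\<dots> = measure ?\<mu> (?P True) * measure ?\<mu> (?P False)"
        unfolding law2 by (rule measure_pair_pmf_Times)
      also have "\<dots> = (\<Prod>b\<in>UNIV. \<Prod>j\<in>{1..n}. measure (?G j) (S (b, j)))"
        by (simp add: code_pmf_def measure_Pi_pmf_Pi UNIV_bool mult.commute)
      also have "\<dots> = (\<Prod>z\<in>UNIV \<times> {1..n}. measure (?G (snd z)) (S z))"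
        by (simp add: prod.cartesian_product case_prod_beta)
      finally show ?thesis .
    qed
    have "M.indep_vars (\<lambda>z. count_space {1..snd z}) V (UNIV \<times> {1..})"
    proof (rule M.indep_vars_count_space[where G = "\<lambda>z. ?G (snd z)"])
      fix z :: "bool \<times> nat" assume z: "z \<in> UNIV \<times> {1..}"
      show "V z \<in> M \<rightarrow>\<^sub>M count_space {1..snd z}"
        unfolding V_def by (rule measurable_count_space_subset[OF W_meas W_range]) (use z in auto)
    next
      fix J :: "(bool \<times> nat) set" and S assume "finite J" "J \<subseteq> UNIV \<times> {1..}"
      \<comment> \<open>The parity of a coordinate separates the two processes, its half gives the
        time.\<close>
      moreover have "inj_on (\<lambda>z. 2 * snd z + t z) (UNIV \<times> {1..})"
        by (auto simp: inj_on_def t_def split: if_splits) presburger+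
      moreover have "map_pmf (w (snd z)) (D (2 * snd z + t z)) = ?G (snd z)"
        if "z \<in> UNIV \<times> {1..} - UNIV \<times> {1..n}" for z
        using that w_law[of "snd z" "t z"] by (auto simp: t_def)
      ultimately show "M.prob {\<omega> \<in> space M. \<forall>z\<in>J. V z \<omega> \<in> S z} =
          (\<Prod>z\<in>J. measure (?G (snd z)) (S z))"
        unfolding M_def V
        by (intro joint_law_combined[where I = "UNIV \<times> {1..}" and A = "UNIV \<times> {1..n}"
              and v = "\<lambda>k z. cl k (t z) (snd z)" and w = "\<lambda>z. w (snd z)"
              and c = "\<lambda>z. 2 * snd z + t z" and G = "\<lambda>z. ?G (snd z)"] fin) auto
    qed
    from M.indep_processes_insert_perm[OF this] show ?thesis by (simp add: V_def t_def)
  qed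
  \<comment> \<open>Up to time \<open>n\<close> only the coupled codes enter, so the pointwise claim
    reduces to \<open>coupled\<close>.\<close>
  moreover have "insert_perm (\<lambda>i. W t e i \<omega>) n = insert_perm (cl (fst \<omega>) t) n" for t e \<omega>
    by (rule insert_perm_cong) (simp add: W_def)
  moreover have "{j \<in> B. real (insert_perm (\<lambda>i. W t e i \<omega>) j j) > C} = high B C (cl (fst \<omega>) t)" for t e \<omega>
    unfolding high_def using B by (intro Collect_cong conj_cong refl) (auto simp: insert_perm_diag W_def)
  ultimately show ?thesis
    using coupled M.prob_space_axioms mallows[OF law_0, of 0] mallows[OF law_1, of 1] mallows[OF law_2, of 0]
    by (intro exI[of _ M] exI[of _ "\<lambda>n \<omega>. insert_perm (\<lambda>i. W 0 0 i \<omega>) n"]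
        exI[of _ "\<lambda>n \<omega>. insert_perm (\<lambda>i. W 1 1 i \<omega>) n"]
        exI[of _ "\<lambda>n \<omega>. insert_perm (\<lambda>i. W 2 0 i \<omega>) n"]) (simp add: Let_def)
qed

end
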